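(* Let $\mathcal{S}=\{S_k\}_{k\in\mathbb{N}_0}$ be a subdivision scheme belonging to class B (with the data $p,q,D,\pi_k,\vec\Lambda_0,\vec\Lambda_1,\rho,C$ described in the context) such that $$\langle\vec\Lambda_l(\pi),(1,\ldots,1)\rangle=1,\qquad\forall\pi\in D,\ l=0,1.$$ Suppose that there exist $\pi_k^{[1]}:(\mathbb{R}^n)^{2p+1}\to D$, $k\in\mathbb{N}_0$, such that $\pi_k(f_{-p},\ldots,f_{p+1})=\pi_k^{[1]}(\nabla f_{-p},\ldots,\nabla f_p)$ for all $f_{-p},\ldots,f_{p+1}\in\mathbb{R}^n$. Then there exist a linear subdivision operator $T$ on $\ell_\infty(\mathbb{Z},\mathbb{R}^n)$ whose associated stationary subdivision scheme $\{T,T,T,\ldots\}$ is convergent, and operators $\mathcal{F}_k:\ell_\infty(\mathbb{Z},\mathbb{R}^n)\to\ell_\infty(\mathbb{Z},\mathbb{R}^n)$ (possibly non-linear), such that $$S_k=T+\mathcal{F}_k\circ\nabla,\qquad k\in\mathbb{N}_0,$$ and there exist $M>0$, $c\in(0,1)$, $k_0,K\in\mathbb{N}_0$ such that, for all $k\ge k_0$, $$\|\mathcal{F}_k\delta\|_\infty\le M\|\delta\|_\infty\quad\forall\delta\in\ell_\infty(\mathbb{Z},\mathbb{R}^n),\qquad\|\nabla S_{k+K}\cdots S_kf\|_\infty\le c\|\nabla f\|_\infty\quad\forall f\in\ell_\infty(\mathbb{Z},\mathbb{R}^n).$$ Consequently, $\mathcal{S}$ is convergent.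
   Context: Notation: $\mathbb{N}_0=\{0,1,2,\ldots\}$, $\mathbb{N}=\{1,2,\ldots\}$; $\ell_\infty(\mathbb{Z},\mathbb{R}^n)$ is the set of bounded sequences $f=(f_i)_{i\in\mathbb{Z}}$, $f_i\in\mathbb{R}^n$, with $\|f\|_\infty=\sup_i|f_i|$ for a fixed norm on $\mathbb{R}^n$; $\nabla f_i:=f_{i+1}-f_i$ and $\nabla f=(\nabla f_i)_i$. For $a=(a_j)$ real and $b=(b_j)$ with $b_j\in\mathbb{R}^m$, of equal finite length, $\langle a,b\rangle:=\sum_j a_jb_j\in\mathbb{R}^m$. Subdivision schemes: a subdivision operator is a map $S$ of the form $(Sf)_{2i+l}=\Psi_{2i+l}(f_{i-p},\ldots,f_{i+p+1})$, $l=0,1$, $i\in\mathbb{Z}$, for some $p\in\mathbb{N}_0$ and $\Psi_j:(\mathbb{R}^n)^{2p+2}\to\mathbb{R}^n$; it is linear if all the $\Psi_j$ are linear. A uniform subdivision scheme is a sequence $\mathcal{S}=\{S_k\}_{k\in\mathbb{N}_0}$ of operators $S_k:\ell_\infty(\mathbb{Z},\mathbb{R}^n)\to\ell_\infty(\mathbb{Z},\mathbb{R}^n)$ of the form $(S_kf)_{2i+l}=\Psi^k_l(f_{i-p},\ldots,f_{i+p+1})$, $l=0,1$, $i\in\mathbb{Z}$, with $\Psi^k_0,\Psi^k_1:(\mathbb{R}^n)^{2p+2}\to\mathbb{R}^n$; it is stationary if the rules do not depend on $k$. Convergence: $\{f^k\}$ converges uniformly to a continuous $G:\mathbb{R}\to\mathbb{R}^n$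 iff for every compact interval $I\subset\mathbb{R}$, $\lim_{k\to\infty}\sup_{i\in\mathbb{Z}\cap2^kI}|f^k_i-G(i2^{-k})|=0$. A scheme is convergent iff for every $f^0\in\ell_\infty(\mathbb{Z},\mathbb{R}^n)$ the sequence $f^{k+1}=S_kf^k$ converges uniformly to a continuous function $S^\infty f^0$, and $S^\infty\ne0$. Class B: $\mathcal{S}$ belongs to class B iff it is uniform and there exist $q\in\mathbb{N}$, $D\subset\mathbb{R}^q$ with $0\in D$, maps $\pi_k:(\mathbb{R}^n)^{2p+2}\to D$ ($k\in\mathbb{N}_0$), $\vec\Lambda_0,\vec\Lambda_1:D\to\mathbb{R}^{2p+2}$ and $\rho,C>0$ such that, for some norms $|\cdot|_{\mathbb{R}^q},|\cdot|_{\mathbb{R}^{2p+2}}$, for $l=0,1$, all $k\in\mathbb{N}_0$ and all $f_{-p},\ldots,f_{p+1}\in\mathbb{R}^n$, $$\Psi^k_l(f_{-p},\ldots,f_{p+1})=\langle\vec\Lambda_l(\pi_k(f_{-p},\ldots,f_{p+1})),(f_{-p},\ldots,f_{p+1})\rangle,$$ $$|\pi_k(f_{-p},\ldots,f_{p+1})|_{\mathbb{R}^q}\le2^{-k}\rho,\qquad|\vec\Lambda_l(\pi)-\vec\Lambda_l(0)|_{\mathbb{R}^{2p+2}}\le C|\pi|_{\mathbb{R}^q}\ \ \forall\pi\in D;$$ moreover it is required that the linear uniform stationary scheme with rules $\Psi^*_l(f_{-p},\ldots,f_{p+1})=\langle\vec\Lambda_l(0),(f_{-p},\ldots,f_{p+1})\rangle$,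 $l=0,1$, is convergent. *)

theory Defs
  imports "HOL-Analysis.Analysis"
begin

section \<open>Norms, bounded sequences, tuples\<close>

definition is_norm :: "('v::real_vector \<Rightarrow> real) \<Rightarrow> bool" where
  "is_norm N \<longleftrightarrow>
     (\<forall>x. 0 \<le> N x) \<and> (\<forall>x. N x = 0 \<longleftrightarrow> x = 0) \<and>
     (\<forall>a x. N (a *\<^sub>R x) = \<bar>a\<bar> * N x) \<and>
     (\<forall>x y. N (x + y) \<le> N x + N y)"

text \<open>
  Tuples whose length depends on the numerical parameter \<open>p\<close> are lists of that length:
  \<open>(f\<^sub>-\<^sub>p, \<dots>, f\<^sub>p\<^sub>+\<^sub>1)\<close> is a list of length \<open>2 * p + 2\<close>, read from left to right. Functions on
  tuples are only ever constrained on lists of the appropriate length.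
\<close>

definition is_tuple_norm :: "nat \<Rightarrow> (real list \<Rightarrow> real) \<Rightarrow> bool" where
  "is_tuple_norm m N \<longleftrightarrow>
     (\<forall>x. length x = m \<longrightarrow> 0 \<le> N x) \<and>
     (\<forall>x. length x = m \<longrightarrow> (N x = 0 \<longleftrightarrow> x = replicate m 0)) \<and>
     (\<forall>a x. length x = m \<longrightarrow> N (map (\<lambda>t. a * t) x) = \<bar>a\<bar> * N x) \<and>
     (\<forall>x y. length x = m \<longrightarrow> length y = m \<longrightarrow> N (map2 (+) x y) \<le> N x + N y)"

definition pairing :: "real list \<Rightarrow> 'v::real_vector list \<Rightarrow> 'v" where
  "pairing a b = sum_list (map2 (*\<^sub>R) a b)"

definition tuple_diff :: "'v::ab_group_add list \<Rightarrow> 'v list" where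
  "tuple_diff xs = map2 (\<lambda>x y. y - x) xs (tl xs)"

text \<open>
  Boundedness in \<open>\<real>\<^sup>n\<close> does not depend on the norm, so \<open>linf\<close> uses the library notion, whereas
  the value of the supremum norm refers to the chosen norm \<open>N\<close>.
\<close>

definition linf :: "(int \<Rightarrow> real ^ 'n) set" where
  "linf = {f. bounded (range f)}"

definition supnorm :: "(real ^ 'n \<Rightarrow> real) \<Rightarrow> (int \<Rightarrow> real ^ 'n) \<Rightarrow> real" where
  "supnorm N f = (SUP i. N (f i))"

definition nabla :: "(int \<Rightarrow> real ^ 'n) \<Rightarrow> int \<Rightarrow> real ^ 'n" where
  "nabla f i = f (i + 1) - f i"


section \<open>Subdivision operators and schemes\<close>

type_synonym 'v seqop = "(int \<Rightarrow> 'v) \<Rightarrow> int \<Rightarrow> 'v"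

text \<open>
  Operators are total functions on sequences, but only their restriction to \<open>linf\<close> is meaningful:
  all requirements and all equalities between operators are imposed on \<open>linf\<close> only.
\<close>

definition maps_linf :: "(real ^ 'n) seqop \<Rightarrow> bool" where
  "maps_linf A \<longleftrightarrow> (\<forall>f\<in>linf. A f \<in> linf)"

definition window :: "nat \<Rightarrow> (int \<Rightarrow> 'v) \<Rightarrow> int \<Rightarrow> 'v list" where
  "window p f i = map f [i - int p .. i + int p + 1]"

definition linear_rule :: "nat \<Rightarrow> ((real ^ 'n) list \<Rightarrow> real ^ 'n) \<Rightarrow> bool" where
  "linear_rule m \<psi> \<longleftrightarrow>
     (\<forall>x y. length x = m \<longrightarrow> length y = m \<longrightarrow> \<psi> (map2 (+) x y) = \<psi> x + \<psi> y) \<and>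
     (\<forall>a x. length x = m \<longrightarrow> \<psi> (map ((*\<^sub>R) a) x) = a *\<^sub>R \<psi> x)"

text \<open>General subdivision operators may have a different rule at every position of the output.\<close>

definition linear_subdivision_operator :: "(real ^ 'n) seqop \<Rightarrow> bool" where
  "linear_subdivision_operator A \<longleftrightarrow> maps_linf A \<and>
     (\<exists>p \<Psi>. (\<forall>j. linear_rule (2 * p + 2) (\<Psi> j)) \<and>
       (\<forall>f\<in>linf. \<forall>i. \<forall>l\<in>{0, 1}. A f (2 * i + l) = \<Psi> (2 * i + l) (window p f i)))"

definition has_uniform_rules ::
  "nat \<Rightarrow> (nat \<Rightarrow> int \<Rightarrow> (real ^ 'n) list \<Rightarrow> real ^ 'n) \<Rightarrow> (nat \<Rightarrow> (real ^ 'n) seqop) \<Rightarrow> bool" where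
  "has_uniform_rules p \<Psi> S \<longleftrightarrow>
     (\<forall>k. maps_linf (S k) \<and>
       (\<forall>f\<in>linf. \<forall>i. \<forall>l\<in>{0, 1}. S k f (2 * i + l) = \<Psi> k l (window p f i)))"

definition stationary_scheme :: "(nat \<Rightarrow> (real ^ 'n) seqop) \<Rightarrow> bool" where
  "stationary_scheme S \<longleftrightarrow> (\<exists>p \<Psi>. has_uniform_rules p (\<lambda>k. \<Psi>) S)"

text \<open>The operator with rules \<open>\<psi> 0\<close>, \<open>\<psi> 1\<close>; an index \<open>j = 2 * i + l\<close> has
  \<open>i = j div 2\<close> and \<open>l = j mod 2\<close>.\<close>

definition uniform_operator :: "nat \<Rightarrow> (int \<Rightarrow> (real ^ 'n) list \<Rightarrow> real ^ 'n) \<Rightarrow> (real ^ 'n) seqop" where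
  "uniform_operator p \<psi> f j = \<psi> (j mod 2) (window p f (j div 2))"

text \<open>\<open>compose_from S k m\<close> is the product \<open>S (k + m - 1) \<circ> \<dots> \<circ> S k\<close> of \<open>m\<close> operators.\<close>

primrec compose_from :: "(nat \<Rightarrow> (real ^ 'n) seqop) \<Rightarrow> nat \<Rightarrow> nat \<Rightarrow> (real ^ 'n) seqop" where
  "compose_from S k 0 f = f"
| "compose_from S k (Suc m) f = S (k + m) (compose_from S k m f)"


section \<open>Convergence\<close>

text \<open>The supremum is taken in \<open>ennreal\<close> so that it is 0 when no grid point lies in the interval.\<close>

definition converges_uniformly ::
  "(real ^ 'n \<Rightarrow> real) \<Rightarrow> (nat \<Rightarrow> int \<Rightarrow> real ^ 'n) \<Rightarrow> (real \<Rightarrow> real ^ 'n) \<Rightarrow> bool" where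
  "converges_uniformly N f G \<longleftrightarrow>
     (\<forall>a b. (\<lambda>k. SUP i\<in>{i. real_of_int i / 2 ^ k \<in> {a..b}}.
               ennreal (N (f k i - G (real_of_int i / 2 ^ k)))) \<longlonglongrightarrow> 0)"

definition convergent_scheme :: "(real ^ 'n \<Rightarrow> real) \<Rightarrow> (nat \<Rightarrow> (real ^ 'n) seqop) \<Rightarrow> bool" where
  "convergent_scheme N S \<longleftrightarrow>
     (\<exists>Sinf :: (int \<Rightarrow> real ^ 'n) \<Rightarrow> real \<Rightarrow> real ^ 'n.
        (\<forall>f\<in>linf. continuous_on UNIV (Sinf f) \<and>
           converges_uniformly N (\<lambda>k. compose_from S 0 k f) (Sinf f)) \<and>
        (\<exists>f\<in>linf. \<exists>t. Sinf f t \<noteq> 0))"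


section \<open>Class B\<close>

definition class_B ::
  "(real ^ 'n \<Rightarrow> real) \<Rightarrow> nat \<Rightarrow> (real ^ 'q) set \<Rightarrow> (nat \<Rightarrow> (real ^ 'n) list \<Rightarrow> real ^ 'q) \<Rightarrow>
   (int \<Rightarrow> real ^ 'q \<Rightarrow> real list) \<Rightarrow> real \<Rightarrow> real \<Rightarrow> (nat \<Rightarrow> (real ^ 'n) seqop) \<Rightarrow> bool" where
  "class_B N p D \<pi> \<Lambda> \<rho> C S \<longleftrightarrow>
     0 \<in> D \<and> \<rho> > 0 \<and> C > 0 \<and>
     (\<forall>k x. length x = 2 * p + 2 \<longrightarrow> \<pi> k x \<in> D) \<and>
     (\<forall>l\<in>{0, 1}. \<forall>v\<in>D. length (\<Lambda> l v) = 2 * p + 2) \<and>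
     has_uniform_rules p (\<lambda>k l x. pairing (\<Lambda> l (\<pi> k x)) x) S \<and>
     (\<exists>Nq Nm. is_norm Nq \<and> is_tuple_norm (2 * p + 2) Nm \<and>
        (\<forall>k x. length x = 2 * p + 2 \<longrightarrow> Nq (\<pi> k x) \<le> 2 powi (- int k) * \<rho>) \<and>
        (\<forall>l\<in>{0, 1}. \<forall>v\<in>D. Nm (map2 (-) (\<Lambda> l v) (\<Lambda> l 0)) \<le> C * Nq v)) \<and>
     convergent_scheme N (\<lambda>k. uniform_operator p (\<lambda>l x. pairing (\<Lambda> l 0) x))"

end

theory Submission
  imports Defs
begin

text \<open>
  Let \<open>T\<close> have the weights \<open>\<Lambda> 0\<close>. Convergence of \<open>T\<close> forces \<open>nabla \<circ> T\<^sup>m\<close> to be small relative to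
  \<open>nabla\<close> for large \<open>m\<close>: by locality and translation invariance only finitely many impulse responses
  matter, and they approach continuous limits. The corrections \<open>F k \<circ> nabla\<close> have size
  \<open>O(2\<^sup>-\<^sup>k)\<close> relative to \<open>nabla\<close>, so for large \<open>k\<close> the product of \<open>m\<close> consecutive operators of \<open>S\<close>
  inherits the contraction. Hence the suprema of \<open>nabla\<close> along the scheme are summable, and the step
  functions built from the data converge uniformly to a continuous limit.
\<close>

section \<open>Norms and sequences\<close>

text \<open>The order of the choices matters. For a product of \<open>m\<close> operators of
  \<open>S\<close> started at level \<open>k\<close>, the deviation from \<open>m\<close> linear
  steps is at most a constant times \<open>(1 / 2) ^ k\<close> times the size of the differences,
  but nothing is known about the growth of this constant with \<open>m\<close>. So \<open>m\<close>
  is fixed by the linear scheme alone, and only afterwards is \<open>k\<close> taken large. The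
  factor \<open>(1 / 2) ^ k\<close> arises from the bound on \<open>\<pi> k\<close>, fed into the
  Lipschitz estimate for the weights at 0. Unit row sums enter twice: the linear operator reproduces
  constants, so its iterates can be measured against differences, and a change of weights
  annihilates constants, so the correction is a function of differences. All estimates are made in
  the Euclidean norm with an arbitrarily small contraction factor, because passing to the given norm
  \<open>N\<close> costs a fixed multiple.\<close>

lemma is_norm_equivalent:
  fixes N :: "real ^ 'n \<Rightarrow> real"
  assumes "is_norm N"
  shows "\<exists>a>0. \<exists>b>0. \<forall>x. norm x \<le> a * N x \<and> N x \<le> b * norm x"
proof -
  have nn: "0 \<le> N x" and zero: "N x = 0 \<longleftrightarrow> x = 0" and scale: "N (r *\<^sub>R x) = \<bar>r\<bar> * N x"
    and tri: "N (x + y) \<le> N x + N y" for x y r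
    using assms unfolding is_norm_def by auto
  \<comment> \<open>A finite convex function on a finite-dimensional space is continuous, so
    \<open>N\<close> attains its extrema on the unit sphere; homogeneity does the rest.\<close>
  have "convex_on UNIV N"
  proof (rule convex_onI)
    fix t :: real and x y :: "real ^ 'n"
    assume "0 < t" "t < 1"
    then show "N ((1 - t) *\<^sub>R x + t *\<^sub>R y) \<le> (1 - t) * N x + t * N y"
      using tri[of "(1 - t) *\<^sub>R x" "t *\<^sub>R y"] by (simp add: scale)
  qed simp
  then have cont: "continuous_on (sphere 0 1) N"
    using convex_on_continuous[of UNIV N] continuous_on_subset by blast
  have ne: "sphere (0 :: real ^ 'n) 1 \<noteq> {}"
    using vector_choose_size[of 1] by (auto simp: sphere_def)
  obtain x0 where x0: "norm x0 = 1" "\<And>y. norm y = 1 \<Longrightarrow> N x0 \<le> N y"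
    using continuous_attains_inf[OF compact_sphere ne cont] by (auto simp: sphere_def)
  obtain x1 where x1: "norm x1 = 1" "\<And>y. norm y = 1 \<Longrightarrow> N y \<le> N x1"
    using continuous_attains_sup[OF compact_sphere ne cont] by (auto simp: sphere_def)
  have pos: "N x0 > 0" "N x1 > 0"
    using x0(1) x1(1) nn zero by (metis less_eq_real_def norm_zero zero_neq_one)+
  have "norm x \<le> 1 / N x0 * N x \<and> N x \<le> N x1 * norm x" for x
  proof (cases "x = 0")
    case True
    then show ?thesis using zero[of 0] by simp
  next
    case False
    define y where "y = x /\<^sub>R norm x"
    have "norm y = 1" using False by (simp add: y_def)
    moreover have "N x = norm x * N y"
      using False by (simp add: y_def scale)
    ultimately show ?thesis
      using x0(2)[of y] x1(2)[of y] pos by (simp add: field_simps mult_right_mono mult.commute[of "norm x"])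
  qed
  then show ?thesis using pos by (intro exI[of _ "1 / N x0"] exI[of _ "N x1"]) auto
qed

text \<open>Compactness argument, carried out on functions \<open>nat \<Rightarrow> real\<close>
  with the product topology. The seminorm \<open>V\<close> reads only the first \<open>m\<close>
  coordinates, and it is continuous because its variation is dominated by a finite sum of coordinate
  differences.\<close>

lemma tuple_norm_bounds_coordinates:
  assumes "is_tuple_norm m N"
  shows "\<exists>\<kappa>>0. \<forall>x. length x = m \<longrightarrow> (\<forall>j<m. \<bar>x ! j\<bar> \<le> \<kappa> * N x)"
proof -
  define V where "V x = N (map x [0..<m])" for x :: "nat \<Rightarrow> real"
  have nn: "0 \<le> V x" for x
    using assms by (simp add: is_tuple_norm_def V_def)
  have scale: "V (\<lambda>i. c * x i) = \<bar>c\<bar> * V x" for c x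
  proof -
    have "N (map (\<lambda>t. c * t) (map x [0..<m])) = \<bar>c\<bar> * N (map x [0..<m])"
      using assms unfolding is_tuple_norm_def by (metis length_map length_upt diff_zero)
    then show ?thesis by (simp add: V_def o_def)
  qed
  have tri: "V (\<lambda>i. x i + y i) \<le> V x + V y" for x y
  proof -
    have "map2 (+) (map x [0..<m]) (map y [0..<m]) = map (\<lambda>i. x i + y i) [0..<m]"
      by (simp add: map2_map_map)
    then show ?thesis
      using assms unfolding is_tuple_norm_def V_def
      by (metis length_map length_upt diff_zero)
  qed
  have zero: "V (\<lambda>i. 0) = 0"
    using scale[of 0 "\<lambda>i. 0"] by simp
  have pos: "V x > 0" if "j < m" "x j \<noteq> 0" for x j
  proof -
    have "map x [0..<m] \<noteq> replicate m 0"
      using that by (auto simp: list_eq_iff_nth_eq)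
    then have "V x \<noteq> 0"
      using assms by (simp add: is_tuple_norm_def V_def)
    then show ?thesis using nn[of x] by simp
  qed
  define e where "e i = (\<lambda>j::nat. if j = i then 1 else 0 :: real)" for i
  have upper: "V x \<le> (\<Sum>i<m. \<bar>x i\<bar> * V (e i))" for x
  proof -
    have part: "V (\<lambda>j. \<Sum>i<n. x i * e i j) \<le> (\<Sum>i<n. \<bar>x i\<bar> * V (e i))" for n
    proof (induction n)
      case 0
      then show ?case by (simp add: zero)
    next
      case (Suc n)
      then show ?case
        using tri[of "\<lambda>j. \<Sum>i<n. x i * e i j" "\<lambda>j. x n * e n j"] by (simp add: scale)
    qed
    have "V x = V (\<lambda>j. \<Sum>i<m. x i * e i j)"
      unfolding V_def by (rule arg_cong[where f = N]) (auto simp: e_def if_distrib cong: if_cong)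
    then show ?thesis using part[of m] by simp
  qed
  have "continuous_on UNIV V"
    unfolding continuous_on_def
  proof
    fix x :: "nat \<Rightarrow> real"
    have lim: "((\<lambda>y. \<Sum>i<m. \<bar>y i - x i\<bar> * V (e i)) \<longlongrightarrow> 0) (at x)"
    proof -
      have c: "((\<lambda>y. y i) \<longlongrightarrow> x i) (at x)" for i
        using continuous_on_product_coordinates[of i, where ?'b = real]
        unfolding continuous_on_def by simp
      have "((\<lambda>y. \<Sum>i<m. \<bar>y i - x i\<bar> * V (e i)) \<longlongrightarrow> (\<Sum>i<m. \<bar>x i - x i\<bar> * V (e i))) (at x)"
        by (intro tendsto_intros c)
      then show ?thesis by simp
    qed
    have le: "\<bar>V y - V x\<bar> \<le> (\<Sum>i<m. \<bar>y i - x i\<bar> * V (e i))" for y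
    proof -
      have "V y \<le> V x + V (\<lambda>i. y i - x i)" "V x \<le> V y + V (\<lambda>i. x i - y i)"
        using tri[of x "\<lambda>i. y i - x i"] tri[of y "\<lambda>i. x i - y i"] by auto
      moreover have "V (\<lambda>i. x i - y i) = V (\<lambda>i. y i - x i)"
        using scale[of "-1" "\<lambda>i. y i - x i"] by simp
      ultimately show ?thesis using upper[of "\<lambda>i. y i - x i"] by linarith
    qed
    have "((\<lambda>y. V y - V x) \<longlongrightarrow> 0) (at x)"
      by (rule Lim_null_comparison[OF _ lim]) (use le in auto)
    then show "(V \<longlongrightarrow> V x) (at x)"
      using Lim_null by blast
  qed
  \<comment> \<open>The cube has infinitely many sides and is compact by Tychonoff. On each face
    \<open>x j = 1\<close> with \<open>j < m\<close> the seminorm is positive, hence bounded away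
    from zero.\<close>
  define B where "B = PiE UNIV (\<lambda>i::nat. {-1..1::real})"
  have comp: "compact B"
    unfolding B_def
    using compactin_PiE[of "\<lambda>i. euclideanreal" "UNIV :: nat set" "\<lambda>i. {-1..1}"]
    by (simp add: euclidean_product_topology)
  have "\<exists>\<kappa>>0. \<forall>x\<in>B. x j = 1 \<longrightarrow> 1 \<le> \<kappa> * V x" if j: "j < m" for j
  proof -
    have "closed {x. (x :: nat \<Rightarrow> real) j = 1}"
      by (intro closed_Collect_eq continuous_on_product_coordinates continuous_on_const)
    then have c: "compact (B \<inter> {x. x j = 1})"
      by (rule compact_Int_closed[OF comp])
    have "(\<lambda>i. 1) \<in> B \<inter> {x. x j = 1}" by (simp add: B_def PiE_iff)
    then have "B \<inter> {x. x j = 1} \<noteq> {}" by blast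
    then obtain x0 where x0: "x0 j = 1" "\<And>x. x \<in> B \<Longrightarrow> x j = 1 \<Longrightarrow> V x0 \<le> V x"
      using continuous_attains_inf[OF c] continuous_on_subset[OF \<open>continuous_on UNIV V\<close>]
      by (metis (mono_tags, lifting) Int_iff mem_Collect_eq subset_UNIV)
    then have "V x0 > 0" using pos[OF j, of x0] by simp
    then show ?thesis using x0(2) by (intro exI[of _ "1 / V x0"]) auto
  qed
  then obtain \<kappa> where \<kappa>: "\<And>j. j < m \<Longrightarrow> \<kappa> j > 0"
    "\<And>j x. j < m \<Longrightarrow> x \<in> B \<Longrightarrow> x j = 1 \<Longrightarrow> 1 \<le> \<kappa> j * V x"
    by metis
  define \<kappa>' where "\<kappa>' = 1 + (\<Sum>j<m. \<kappa> j)"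
  have \<kappa>'_ge: "\<kappa> j \<le> \<kappa>'" if "j < m" for j
    using member_le_sum[of j "{..<m}" \<kappa>] \<kappa>(1) that unfolding \<kappa>'_def by fastforce
  have "\<kappa>' > 0"
    unfolding \<kappa>'_def using \<kappa>(1) by (intro add_pos_nonneg sum_nonneg) (auto intro: less_imp_le)
  have "\<bar>x ! j\<bar> \<le> \<kappa>' * N x" if x: "length x = m" and j: "j < m" for x j
  proof -
    define y where "y i = (if i < m then x ! i else 0)" for i
    have Vy: "V y = N x"
      unfolding V_def by (rule arg_cong[where f = N]) (use x in \<open>auto simp: list_eq_iff_nth_eq y_def\<close>)
    let ?A = "(\<lambda>i. \<bar>y i\<bar>) ` {..<m}"
    have "Max ?A \<in> ?A" using j by (intro Max_in) auto
    then obtain J where J: "J < m" "Max ?A = \<bar>y J\<bar>" by auto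
    have J_max: "\<bar>y i\<bar> \<le> \<bar>y J\<bar>" if "i < m" for i
      unfolding J(2)[symmetric] using that by (intro Max_ge) auto
    have "\<bar>y J\<bar> \<le> \<kappa>' * V y"
    proof (cases "y J = 0")
      case True
      then show ?thesis using nn \<open>\<kappa>' > 0\<close> by simp
    next
      case False
      \<comment> \<open>Dividing by the entry of largest modulus, with its sign, places the tuple in
        the cube and on the face \<open>z J = 1\<close>.\<close>
      define z where "z i = (1 / y J) * y i" for i
      have "\<bar>z i\<bar> \<le> 1" for i
        using J_max[of i] False by (cases "i < m") (auto simp: z_def y_def abs_divide)
      then have "z i \<in> {-1..1}" for i
        by (metis abs_le_D1 abs_le_D2 atLeastAtMost_iff minus_le_iff)
      then have "z \<in> B" by (simp add: B_def PiE_iff)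
      moreover have "z J = 1" using False by (simp add: z_def)
      ultimately have "1 \<le> \<kappa> J * V z" using \<kappa>(2)[OF J(1)] by blast
      also have "\<dots> \<le> \<kappa>' * V z" using \<kappa>'_ge[OF J(1)] nn by (intro mult_right_mono)
      also have "V z = V y / \<bar>y J\<bar>"
        unfolding z_def scale by simp
      finally show ?thesis using False by (simp add: field_simps)
    qed
    then show ?thesis using J_max[OF j] Vy j by (simp add: y_def)
  qed
  then show ?thesis using \<open>\<kappa>' > 0\<close> by blast
qed

section \<open>Summable steps and limits of dyadic step functions\<close>

text \<open>All terms of a long partial sum after the first \<open>k0 + m\<close> are dominated by
  \<open>c\<close> times that same partial sum, which can then be absorbed on the left. This avoids
  splitting the indices into residue classes modulo \<open>m\<close>.\<close>

lemma summable_if_delayed_contraction: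
  fixes u :: "nat \<Rightarrow> real"
  assumes nn: "\<And>k. 0 \<le> u k" and c: "0 \<le> c" "c < 1" and u: "\<And>k. k0 \<le> k \<Longrightarrow> u (k + m) \<le> c * u k"
  shows "summable u"
proof -
  define U where "U = (\<Sum>k<k0 + m. u k)"
  have bound: "(\<Sum>k<n. u k) \<le> U / (1 - c)" for n
  proof -
    let ?n = "k0 + m + n"
    have "(\<Sum>k<?n. u k) = U + (\<Sum>k<n. u (k0 + k + m))"
      unfolding U_def by (induction n) (auto simp: ac_simps)
    also have "(\<Sum>k<n. u (k0 + k + m)) \<le> (\<Sum>k<n. c * u (k0 + k))"
      by (intro sum_mono u) auto
    also have "\<dots> = c * (\<Sum>k\<in>(+) k0 ` {..<n}. u k)"
      by (simp add: sum_distrib_left sum.reindex)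
    also have "\<dots> \<le> c * (\<Sum>k<?n. u k)"
      using nn c by (intro mult_left_mono sum_mono2) auto
    finally have "(\<Sum>k<?n. u k) \<le> U / (1 - c)"
      using c by (simp add: field_simps)
    moreover have "(\<Sum>k<n. u k) \<le> (\<Sum>k<?n. u k)"
      using nn by (intro sum_mono2) auto
    ultimately show ?thesis by linarith
  qed
  show ?thesis
    by (rule summableI_nonneg_bounded[OF nn bound])
qed

lemma norm_add_diff_le:
  fixes x y z :: "'v::real_normed_vector"
  shows "norm (x + y - z) \<le> norm x + norm y + norm z"
  using norm_triangle_ineq4[of "x + y" z] norm_triangle_ineq[of x y] by linarith

text \<open>The tail bound depends on \<open>v\<close> alone, so applying the lemma separately at
  every point of the line still yields uniform convergence.\<close>

lemma dominated_steps_limit: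
  fixes x :: "nat \<Rightarrow> 'v::banach"
  assumes v: "summable v" and x: "\<And>k. norm (x (Suc k) - x k) \<le> v k"
  shows "\<exists>l. \<forall>k. norm (x k - l) \<le> (\<Sum>j. v (j + k))"
proof -
  have "summable (\<lambda>k. x (Suc k) - x k)"
    using x by (intro summable_comparison_test'[OF v, of 0]) auto
  then have "(\<lambda>n. \<Sum>k<n. x (Suc k) - x k) \<longlonglongrightarrow> (\<Sum>k. x (Suc k) - x k)"
    by (rule summable_LIMSEQ)
  then have "(\<lambda>n. x n - x 0) \<longlonglongrightarrow> (\<Sum>k. x (Suc k) - x k)"
    by (simp add: sum_lessThan_telescope)
  from tendsto_add[OF this tendsto_const[of "x 0"]]
  obtain l where l: "x \<longlonglongrightarrow> l" by auto
  have "norm (x k - l) \<le> (\<Sum>j. v (j + k))" for k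
  proof -
    have "(\<lambda>n. x (n + k)) \<longlonglongrightarrow> l" using l by (rule LIMSEQ_ignore_initial_segment)
    then have s: "(\<lambda>j. x (Suc j + k) - x (j + k)) sums (l - x (0 + k))"
      by (rule telescope_sums)
    have "norm (\<Sum>j. x (Suc j + k) - x (j + k)) \<le> (\<Sum>j. v (j + k))"
      using x by (intro norm_suminf_le summable_ignore_initial_segment[OF v]) auto
    then show ?thesis using sums_unique[OF s] by (simp add: norm_minus_commute)
  qed
  then show ?thesis by blast
qed

text \<open>The step functions \<open>t \<mapsto> f k \<lfloor>2\<^sup>k t\<rfloor>\<close> form a uniform Cauchy sequence whose jumps tend to zero,
  so their limit is continuous.\<close>

lemma dyadic_limit_exists:
  fixes f :: "nat \<Rightarrow> int \<Rightarrow> 'v::banach"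
  assumes refine: "\<And>k j. norm (f (Suc k) j - f k (j div 2)) \<le> B * u k"
    and step: "\<And>k i. norm (f k (i + 1) - f k i) \<le> u k"
    and u: "summable u"
  shows "\<exists>G. continuous_on UNIV G \<and>
    (\<exists>\<tau>. \<tau> \<longlonglongrightarrow> 0 \<and> (\<forall>k i. norm (f k i - G (real_of_int i / 2 ^ k)) \<le> \<tau> k))"
proof -
  define g where "g k t = f k \<lfloor>2 ^ k * t\<rfloor>" for k and t :: real
  define \<tau> where "\<tau> k = (\<Sum>j. B * u (j + k))" for k
  have Bu: "summable (\<lambda>k. B * u k)" using u by (rule summable_mult)
  have "\<exists>l. \<forall>k. norm (g k t - l) \<le> \<tau> k" for t
    unfolding \<tau>_def
  proof (rule dominated_steps_limit[OF Bu])
    fix k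
    have "\<lfloor>2 ^ k * t\<rfloor> = \<lfloor>2 ^ Suc k * t\<rfloor> div 2"
      using floor_divide_real_eq_div[of 2 "2 ^ Suc k * t"] by simp
    then show "norm (g (Suc k) t - g k t) \<le> B * u k"
      using refine[of k "\<lfloor>2 ^ Suc k * t\<rfloor>"] by (simp add: g_def)
  qed
  then obtain G where G: "\<And>t k. norm (g k t - G t) \<le> \<tau> k" by metis
  have \<tau>0: "\<tau> \<longlonglongrightarrow> 0"
    unfolding \<tau>_def by (rule suminf_exist_split2[OF Bu])
  \<comment> \<open>Points closer than \<open>(1 / 2) ^ k\<close> lie in the same or in adjacent
    dyadic cells of level \<open>k\<close>, so the step function changes by at most one difference
    between them.\<close>
  have near: "norm (G s - G t) \<le> 2 * \<tau> k + u k" if "\<bar>s - t\<bar> < (1 / 2) ^ k" for s t k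
  proof -
    have "\<bar>2 ^ k * s - 2 ^ k * t\<bar> = 2 ^ k * \<bar>s - t\<bar>"
      by (simp add: abs_mult flip: right_diff_distrib)
    then have "\<bar>2 ^ k * s - 2 ^ k * t\<bar> < 1"
      using that by (simp add: field_simps)
    then have "\<lfloor>2 ^ k * s\<rfloor> = \<lfloor>2 ^ k * t\<rfloor> \<or> \<lfloor>2 ^ k * s\<rfloor> = \<lfloor>2 ^ k * t\<rfloor> + 1 \<or> \<lfloor>2 ^ k * t\<rfloor> = \<lfloor>2 ^ k * s\<rfloor> + 1"
      by linarith
    then have "norm (g k s - g k t) \<le> u k"
      using step[of k "\<lfloor>2 ^ k * s\<rfloor>"] step[of k "\<lfloor>2 ^ k * t\<rfloor>"]
      by (auto simp: g_def norm_minus_commute intro: order_trans[OF norm_ge_zero])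
    moreover have "norm (G s - G t) \<le> norm (g k s - g k t) + norm (g k t - G t) + norm (g k s - G s)"
      using norm_add_diff_le[of "g k s - g k t" "g k t - G t" "g k s - G s"] by simp
    ultimately show ?thesis using G[of k s] G[of k t] by linarith
  qed
  have "continuous_on UNIV G"
    unfolding continuous_on_iff
  proof (intro ballI allI impI)
    fix t :: real and e :: real
    assume "e > 0"
    have "(\<lambda>k. 2 * \<tau> k + u k) \<longlonglongrightarrow> 2 * 0 + 0"
      by (intro tendsto_intros \<tau>0 summable_LIMSEQ_zero[OF u])
    then have "\<forall>\<^sub>F k in sequentially. 2 * \<tau> k + u k < e"
      using \<open>e > 0\<close> by (intro order_tendstoD) auto
    then obtain k where "2 * \<tau> k + u k < e"
      using eventually_happens'[OF sequentially_bot] by blast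
    then show "\<exists>d>0. \<forall>s\<in>UNIV. dist s t < d \<longrightarrow> dist (G s) (G t) < e"
      using near[of _ t k] by (intro exI[of _ "(1 / 2) ^ k"]) (force simp: dist_norm)
  qed
  moreover have "norm (f k i - G (real_of_int i / 2 ^ k)) \<le> \<tau> k" for k i
    using G[of k "real_of_int i / 2 ^ k"] by (simp add: g_def)
  ultimately show ?thesis using \<tau>0 by blast
qed

section \<open>Linear subdivision with a finite mask\<close>

declare sum.lessThan_Suc [simp del]

lemma compose_from_const: "compose_from (\<lambda>_. T) k m f = (T ^^ m) f"
  by (induction m) auto

lemma nth_window:
  assumes "r < 2 * p + 2"
  shows "window p f i ! r = f (i - int p + int r)"
proof -
  have "[i - int p..i + int p + 1] ! r = i - int p + int r"
    using assms by (intro nth_upto) auto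
  then show ?thesis using assms by (simp add: window_def)
qed

lemma length_window [simp]: "length (window p f i) = 2 * p + 2"
  by (simp add: window_def)

lemma pairing_eq_sum:
  assumes "length a = m" "length b = m"
  shows "pairing a b = (\<Sum>r<m. a ! r *\<^sub>R b ! r)"
  using assms by (simp add: pairing_def sum_list_sum_nth atLeast0LessThan)

text \<open>Coefficient form of the rules in \<open>uniform_operator\<close>. As a plain finite sum
  it is linear on arbitrary sequences, so superposition and shifts pass through iterates without
  boundedness conditions.\<close>

definition mask_operator :: "nat \<Rightarrow> (int \<Rightarrow> nat \<Rightarrow> real) \<Rightarrow> (int \<Rightarrow> 'v::real_normed_vector) \<Rightarrow> int \<Rightarrow> 'v" where
  "mask_operator p a f j = (\<Sum>r<2 * p + 2. a (j mod 2) r *\<^sub>R f (j div 2 - int p + int r))"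

definition mask_bound :: "nat \<Rightarrow> (int \<Rightarrow> nat \<Rightarrow> real) \<Rightarrow> real" where
  "mask_bound p a = (\<Sum>r<2 * p + 2. \<bar>a 0 r\<bar> + \<bar>a 1 r\<bar>)"

lemma mask_bound_nonneg: "0 \<le> mask_bound p a"
  by (simp add: mask_bound_def sum_nonneg)

lemma uniform_operator_eq_mask_operator:
  fixes w :: "int \<Rightarrow> real list"
  assumes "\<And>l. l \<in> {0, 1} \<Longrightarrow> length (w l) = 2 * p + 2"
  shows "uniform_operator p (\<lambda>l x. pairing (w l) x) = (mask_operator p (\<lambda>l r. w l ! r) :: (int \<Rightarrow> real ^ 'n) \<Rightarrow> _)"
proof (intro ext)
  fix f :: "int \<Rightarrow> real ^ 'n" and j :: int
  have "j mod 2 \<in> {0, 1}" by auto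
  then show "uniform_operator p (\<lambda>l x. pairing (w l) x) f j = mask_operator p (\<lambda>l r. w l ! r) f j"
    using assms[of "j mod 2"]
    by (simp add: uniform_operator_def mask_operator_def pairing_eq_sum[of _ "2 * p + 2"] nth_window)
qed

text \<open>The vectors \<open>x r\<close> are arbitrary so that the bound serves both for values of
  a sequence and for deviations from a reference value. \<open>mask_bound\<close> adds the absolute
  sums of the two rows and thus covers both parities at once.\<close>

lemma norm_mask_sum_le:
  fixes x :: "nat \<Rightarrow> 'v::real_normed_vector" and j :: int
  assumes "\<And>r. r < 2 * p + 2 \<Longrightarrow> norm (x r) \<le> d"
  shows "norm (\<Sum>r<2 * p + 2. a (j mod 2) r *\<^sub>R x r) \<le> mask_bound p a * d"
proof -
  have d: "0 \<le> d" using assms[of 0] norm_ge_zero[of "x 0"] by linarith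
  have "norm (\<Sum>r<2 * p + 2. a (j mod 2) r *\<^sub>R x r) \<le> (\<Sum>r<2 * p + 2. \<bar>a (j mod 2) r\<bar> * norm (x r))"
    by (rule order_trans[OF norm_sum]) simp
  also have "\<dots> \<le> (\<Sum>r<2 * p + 2. (\<bar>a 0 r\<bar> + \<bar>a 1 r\<bar>) * d)"
  proof (rule sum_mono)
    fix r assume "r \<in> {..<2 * p + 2}"
    moreover have "j mod 2 = 0 \<or> j mod 2 = 1" by auto
    ultimately show "\<bar>a (j mod 2) r\<bar> * norm (x r) \<le> (\<bar>a 0 r\<bar> + \<bar>a 1 r\<bar>) * d"
      using assms d by (intro mult_mono) auto
  qed
  finally show ?thesis by (simp add: mask_bound_def sum_distrib_right)
qed

lemma norm_mask_operator_le:
  assumes "\<And>i. norm (f i) \<le> d"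
  shows "norm (mask_operator p a f j) \<le> mask_bound p a * d"
  unfolding mask_operator_def by (rule norm_mask_sum_le) (rule assms)

lemma mask_operator_sum:
  "mask_operator p a (\<lambda>i. \<Sum>x\<in>X. c x *\<^sub>R g x i) = (\<lambda>j. \<Sum>x\<in>X. c x *\<^sub>R mask_operator p a (g x) j)"
  unfolding mask_operator_def scaleR_sum_right scaleR_scaleR
  by (subst sum.swap) (simp add: mult.commute)

lemma funpow_mask_operator_sum:
  "(mask_operator p a ^^ k) (\<lambda>i. \<Sum>x\<in>X. c x *\<^sub>R g x i)
     = (\<lambda>j. \<Sum>x\<in>X. c x *\<^sub>R (mask_operator p a ^^ k) (g x) j)"
  by (induction k) (simp_all add: mask_operator_sum)

lemma mask_operator_diff:
  "mask_operator p a f j - mask_operator p a g j = mask_operator p a (\<lambda>i. f i - g i) j"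
  by (simp add: mask_operator_def scaleR_diff_right sum_subtractf)

lemma mask_operator_add_const:
  assumes "\<forall>l\<in>{0, 1}. (\<Sum>r<2 * p + 2. a l r) = 1"
  shows "mask_operator p a (\<lambda>i. f i + v) = (\<lambda>j. mask_operator p a f j + v)"
proof
  fix j :: int
  have "j mod 2 \<in> {0, 1}" by auto
  then have "(\<Sum>r<2 * p + 2. a (j mod 2) r) = 1" by (rule bspec[OF assms])
  then show "mask_operator p a (\<lambda>i. f i + v) j = mask_operator p a f j + v"
    unfolding mask_operator_def scaleR_add_right sum.distrib
    by (simp only: scaleR_one flip: scaleR_sum_left)
qed

lemma funpow_mask_operator_add_const:
  assumes "\<forall>l\<in>{0, 1}. (\<Sum>r<2 * p + 2. a l r) = 1"
  shows "(mask_operator p a ^^ k) (\<lambda>i. f i + v) = (\<lambda>j. (mask_operator p a ^^ k) f j + v)"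
  by (induction k) (simp_all add: mask_operator_add_const[OF assms])

lemma funpow_mask_operator_shift:
  "(mask_operator p a ^^ k) (\<lambda>i. f (i + s)) = (\<lambda>j. (mask_operator p a ^^ k) f (j + 2 ^ k * s))"
proof (induction k)
  case (Suc k)
  have "mask_operator p a (\<lambda>j. g (j + t)) = (\<lambda>j. mask_operator p a g (j + 2 * t))"
    for g :: "int \<Rightarrow> 'a" and t
    by (simp add: mask_operator_def fun_eq_iff algebra_simps)
  then show ?case by (simp add: Suc mult.assoc)
qed simp

text \<open>The interval \<open>[-2p, 2p + 2]\<close> is mapped into itself by the dependency relation of the rules,
  so the values on \<open>[0, 2\<^sup>k]\<close> depend on boundedly many initial values, uniformly in \<open>k\<close>.\<close>

lemma funpow_mask_operator_cong:
  assumes "\<And>i. - 2 * int p \<le> i \<Longrightarrow> i \<le> 2 * int p + 3 \<Longrightarrow> f i = g i"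
    and "- 2 * int p \<le> j" "j \<le> 2 ^ k + 2 * int p + 2"
  shows "(mask_operator p a ^^ k) f j = (mask_operator p a ^^ k) g j"
  using assms(2,3)
proof (induction k arbitrary: j)
  case 0
  then show ?case using assms(1) by simp
next
  case (Suc k)
  \<comment> \<open>Halving followed by widening by \<open>p\<close> to the left and
    \<open>p + 1\<close> to the right leads to indices between \<open>- 2 * int p\<close> and
    \<open>2 ^ k + 2 * int p + 2\<close>, which is the range of the induction hypothesis.\<close>
  then have "- int p \<le> j div 2" "j div 2 \<le> 2 ^ k + int p + 1" by auto
  then show ?case
    unfolding funpow.simps o_apply mask_operator_def[of p a "_ f"] mask_operator_def[of p a "_ g"]
    by (intro sum.cong refl arg_cong[where f = "scaleR _"] Suc.IH) auto
qed

section \<open>Decay of differences under a convergent linear scheme\<close>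

text \<open>Up to two approximation errors, a step at level \<open>k\<close> is the increment of
  \<open>G\<close> over an interval of length \<open>(1 / 2) ^ k\<close>, and \<open>G\<close> is
  uniformly continuous on the unit interval. The constant \<open>\<kappa>\<close> converts errors
  measured in \<open>N\<close> into Euclidean ones.\<close>

lemma step_of_dyadic_limit_tendsto_zero:
  fixes N :: "real ^ 'n \<Rightarrow> real"
  assumes N: "is_norm N" and conv: "converges_uniformly N f G" and G: "continuous_on UNIV G"
  shows "\<exists>\<eta>. \<eta> \<longlonglongrightarrow> 0 \<and> (\<forall>k. \<forall>j\<in>{0..<2 ^ k}. norm (nabla (f k) j) \<le> \<eta> k)"
proof -
  obtain \<kappa> where \<kappa>: "\<kappa> > 0" "\<And>x. norm x \<le> \<kappa> * N x"
    using is_norm_equivalent[OF N] by blast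
  define \<eta> where "\<eta> k = Max ((\<lambda>j. norm (nabla (f k) j)) ` {0..<2 ^ k})" for k
  have le: "norm (nabla (f k) j) \<le> \<eta> k" if "j \<in> {0..<2 ^ k}" for k j
    unfolding \<eta>_def using that by (intro Max_ge) auto
  have attained: "\<exists>j\<in>{0..<2 ^ k}. \<eta> k = norm (nabla (f k) j)" for k
  proof -
    have "\<eta> k \<in> (\<lambda>j. norm (nabla (f k) j)) ` {0..<2 ^ k}"
      unfolding \<eta>_def by (intro Max_in) auto
    then show ?thesis by auto
  qed
  have "\<eta> \<longlonglongrightarrow> 0"
  proof (rule LIMSEQ_I)
    fix e :: real assume "e > 0"
    have "uniformly_continuous_on {0..1} G"
      using G continuous_on_subset by (intro compact_uniformly_continuous) auto
    then obtain d where d: "d > 0"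
      "\<And>s t. s \<in> {0..1} \<Longrightarrow> t \<in> {0..1} \<Longrightarrow> dist s t < d \<Longrightarrow> dist (G s) (G t) < e / 3"
      unfolding uniformly_continuous_on_def using \<open>e > 0\<close> by (metis zero_less_divide_iff zero_less_numeral)
    have "\<forall>\<^sub>F k in sequentially. (1 / 2) ^ k < d"
      using LIMSEQ_power_zero[of "1 / 2 :: real"] d(1) by (intro order_tendstoD) auto
    moreover have "\<forall>\<^sub>F k in sequentially. (SUP i\<in>{i. real_of_int i / 2 ^ k \<in> {0..1}}.
        ennreal (N (f k i - G (real_of_int i / 2 ^ k)))) < ennreal (e / (3 * \<kappa>))"
      using conv \<open>e > 0\<close> \<kappa>(1) unfolding converges_uniformly_def
      by (intro order_tendstoD(2)[where y = 0]) (blast, simp)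
    ultimately have "\<forall>\<^sub>F k in sequentially. norm (\<eta> k - 0) < e"
    proof eventually_elim
      case (elim k)
      have close: "norm (f k i - G (real_of_int i / 2 ^ k)) < e / 3" if "0 \<le> i" "i \<le> 2 ^ k" for i
      proof -
        have "real_of_int i \<le> 2 ^ k"
          using that(2) by (metis of_int_le_iff of_int_numeral of_int_power)
        then have i: "i \<in> {i. real_of_int i / 2 ^ k \<in> {0..1}}"
          using that by (simp add: field_simps)
        have "ennreal (N (f k i - G (real_of_int i / 2 ^ k))) < ennreal (e / (3 * \<kappa>))"
          by (rule le_less_trans[OF SUP_upper[OF i] elim(2)])
        then have "N (f k i - G (real_of_int i / 2 ^ k)) < e / (3 * \<kappa>)"
          using \<kappa>(1) \<open>e > 0\<close> N by (subst (asm) ennreal_less_iff) (auto simp: is_norm_def)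
        then have "\<kappa> * N (f k i - G (real_of_int i / 2 ^ k)) < e / 3"
          using \<kappa>(1) by (simp add: field_simps)
        then show ?thesis using \<kappa>(2) le_less_trans by blast
      qed
      obtain j where j: "j \<in> {0..<2 ^ k}" "\<eta> k = norm (nabla (f k) j)"
        using attained by blast
      define s t where "s = real_of_int j / 2 ^ k" and "t = real_of_int (j + 1) / 2 ^ k"
      have "j + 1 \<le> 2 ^ k" using j(1) by simp
      then have "real_of_int (j + 1) \<le> 2 ^ k"
        by (metis of_int_le_iff of_int_numeral of_int_power)
      then have "s \<in> {0..1}" "t \<in> {0..1}" "dist s t = (1 / 2) ^ k"
        using j(1) by (auto simp: s_def t_def field_simps dist_real_def power_one_over)
      then have "norm (G t - G s) < e / 3"
        using d(2)[of s t] elim(1) by (simp add: dist_norm norm_minus_commute)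
      moreover have "norm (f k (j + 1) - G t) < e / 3" "norm (f k j - G s) < e / 3"
        unfolding s_def t_def using j(1) by (intro close; simp)+
      moreover have "norm (nabla (f k) j) = norm ((f k (j + 1) - G t) + (G t - G s) - (f k j - G s))"
        by (simp add: nabla_def)
      ultimately have "norm (nabla (f k) j) < e"
        using norm_triangle_ineq4[of "(f k (j + 1) - G t) + (G t - G s)" "f k j - G s"]
          norm_triangle_ineq[of "f k (j + 1) - G t" "G t - G s"] by linarith
      then show ?case using j(2) by simp
    qed
    then show "\<exists>no. \<forall>k\<ge>no. norm (\<eta> k - 0) < e"
      by (simp add: eventually_sequentially)
  qed
  then show ?thesis using le by blast
qed

lemma norm_diff_le_of_nabla:
  fixes f :: "int \<Rightarrow> real ^ 'n"
  assumes "\<And>i. norm (nabla f i) \<le> d"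
  shows "norm (f i - f j) \<le> \<bar>real_of_int (i - j)\<bar> * d"
proof -
  have up: "norm (f (j + int n) - f j) \<le> real n * d" for j n
  proof (induction n)
    case (Suc n)
    have "f (j + int (Suc n)) - f j = nabla f (j + int n) + (f (j + int n) - f j)"
      by (simp add: nabla_def ac_simps)
    then have "norm (f (j + int (Suc n)) - f j) \<le> d + real n * d"
      using norm_triangle_mono[OF assms Suc] by metis
    then show ?case by (simp add: algebra_simps)
  qed simp
  show ?thesis
  proof (cases "j \<le> i")
    case True
    then show ?thesis using up[of j "nat (i - j)"] by simp
  next
    case False
    then show ?thesis using up[of i "nat (j - i)"] by (simp add: norm_minus_commute)
  qed
qed

text \<open>By translation invariance and reproduction of constants it suffices to look at \<open>[0, 2\<^sup>k]\<close> and
  to subtract \<open>f 0\<close>. There \<open>T\<^sup>k f\<close> is a combination of the iterates of finitely many impulses,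
  whose steps tend to zero because their limits are continuous.\<close>

lemma nabla_funpow_mask_operator_tendsto_zero:
  fixes N :: "real ^ 'n \<Rightarrow> real"
  assumes N: "is_norm N"
    and T: "convergent_scheme N (\<lambda>_. mask_operator p a)"
    and a: "\<forall>l\<in>{0, 1}. (\<Sum>r<2 * p + 2. a l r) = 1"
  shows "\<exists>E. E \<longlonglongrightarrow> 0 \<and> (\<forall>k (f :: int \<Rightarrow> real ^ 'n) d. (\<forall>i. norm (nabla f i) \<le> d) \<longrightarrow>
           (\<forall>j. norm (nabla ((mask_operator p a ^^ k) f) j) \<le> E k * d))"
proof -
  let ?T = "mask_operator p a :: (int \<Rightarrow> real ^ 'n) \<Rightarrow> int \<Rightarrow> real ^ 'n"
  define e where "e s b = (\<lambda>i::int. if i = s then b else 0)" for s and b :: "real ^ 'n"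
  have "\<exists>\<eta>. \<eta> \<longlonglongrightarrow> 0 \<and> (\<forall>k. \<forall>j\<in>{0..<2 ^ k}. norm (nabla ((?T ^^ k) (e s b)) j) \<le> \<eta> k)" for s b
  proof -
    have "range (e s b) \<subseteq> {b, 0}" by (auto simp: e_def)
    then have "e s b \<in> linf"
      unfolding linf_def mem_Collect_eq by (rule bounded_subset[rotated]) (simp add: finite_imp_bounded)
    then show ?thesis
      using T step_of_dyadic_limit_tendsto_zero[OF N]
      unfolding convergent_scheme_def compose_from_const by blast
  qed
  then obtain \<eta> where \<eta>: "\<And>s b. \<eta> s b \<longlonglongrightarrow> 0"
    "\<And>s b k j. j \<in> {0..<2 ^ k} \<Longrightarrow> norm (nabla ((?T ^^ k) (e s b)) j) \<le> \<eta> s b k"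
    by metis
  \<comment> \<open>The positions are exactly those on which the values at 0, ...,
    \<open>2 ^ k\<close> may depend. The weight \<open>\<bar>real_of_int s\<bar>\<close> in
    \<open>E\<close> comes from bounding \<open>f s - f 0\<close> by that many differences.\<close>
  define X where "X = {- 2 * int p..2 * int p + 3} \<times> (Basis :: (real ^ 'n) set)"
  define E where "E k = (\<Sum>(s, b)\<in>X. \<bar>real_of_int s\<bar> * \<eta> s b k)" for k
  have "finite X" by (simp add: X_def)
  have "E \<longlonglongrightarrow> (\<Sum>(s, b)\<in>X. \<bar>real_of_int s\<bar> * 0)"
    unfolding E_def case_prod_unfold by (intro tendsto_intros \<eta>(1))
  then have E0: "E \<longlonglongrightarrow> 0" by simp
  have at_origin: "norm (nabla ((?T ^^ k) f) j) \<le> E k * d"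
    if f: "\<And>i. norm (nabla f i) \<le> d" and j: "j \<in> {0..<2 ^ k}" for k f d j
  proof -
    define g where "g i = f i - f 0" for i
    define h where "h i = (\<Sum>(s, b)\<in>X. (g s \<bullet> b) *\<^sub>R e s b i)" for i
    have gh: "g i = h i" if "- 2 * int p \<le> i" "i \<le> 2 * int p + 3" for i
    proof -
      have "h i = (\<Sum>s\<in>{- 2 * int p..2 * int p + 3}. \<Sum>b\<in>Basis. (g s \<bullet> b) *\<^sub>R e s b i)"
        unfolding h_def X_def by (rule sum.cartesian_product[symmetric])
      also have "\<dots> = (\<Sum>s\<in>{- 2 * int p..2 * int p + 3}. if i = s then \<Sum>b\<in>Basis. (g s \<bullet> b) *\<^sub>R b else 0)"
        unfolding e_def by (intro sum.cong) auto
      finally have "h i = \<dots>" .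
      then show ?thesis using that by (simp add: euclidean_representation)
    qed
    have "(\<lambda>i. g i + f 0) = f" by (simp add: g_def)
    then have "(?T ^^ k) f = (\<lambda>j. (?T ^^ k) g j + f 0)"
      using funpow_mask_operator_add_const[OF a, where f = g and v = "f 0" and k = k] by simp
    then have "nabla ((?T ^^ k) f) j = nabla ((?T ^^ k) g) j"
      by (simp add: nabla_def)
    also have "\<dots> = nabla ((?T ^^ k) h) j"
      unfolding nabla_def using j
      by (intro arg_cong2[where f = minus] funpow_mask_operator_cong gh) auto
    also have "\<dots> = (\<Sum>(s, b)\<in>X. (g s \<bullet> b) *\<^sub>R nabla ((?T ^^ k) (e s b)) j)"
      unfolding h_def case_prod_unfold
      by (simp add: nabla_def funpow_mask_operator_sum scaleR_diff_right sum_subtractf)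
    also have "norm \<dots> \<le> (\<Sum>(s, b)\<in>X. (\<bar>real_of_int s\<bar> * d) * \<eta> s b k)"
      unfolding case_prod_unfold
    proof (rule sum_norm_le)
      fix x assume "x \<in> X"
      then obtain s b where x: "x = (s, b)" "b \<in> Basis" by (auto simp: X_def)
      have "\<bar>g s \<bullet> b\<bar> \<le> \<bar>real_of_int s\<bar> * d"
        using Basis_le_norm[OF x(2), of "g s"] norm_diff_le_of_nabla[of f d s 0, OF f]
        by (simp add: g_def)
      then show "norm ((g (fst x) \<bullet> snd x) *\<^sub>R nabla ((?T ^^ k) (e (fst x) (snd x))) j)
          \<le> \<bar>real_of_int (fst x)\<bar> * d * \<eta> (fst x) (snd x) k"
        using \<eta>(2)[OF j, of s b] x by (simp add: mult_mono)
    qed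
    also have "\<dots> = E k * d"
      by (simp add: E_def case_prod_unfold sum_distrib_left ac_simps)
    finally show ?thesis .
  qed
  have "norm (nabla ((?T ^^ k) f) j) \<le> E k * d" if f: "\<And>i. norm (nabla f i) \<le> d" for k f d j
  proof -
    \<comment> \<open>A shift of the initial data by \<open>s\<close> becomes a shift by
      \<open>2 ^ k * s\<close> after \<open>k\<close> refinements, which moves \<open>j\<close> to
      \<open>j mod 2 ^ k\<close>.\<close>
    define s where "s = j div 2 ^ k"
    have "nabla (\<lambda>j. g (j + 2 ^ k * s)) (j mod 2 ^ k) = nabla g j" for g :: "int \<Rightarrow> real ^ 'n"
    proof -
      have "j mod 2 ^ k + 2 ^ k * s = j" by (simp add: s_def)
      then show ?thesis by (simp add: nabla_def add.commute add.left_commute)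
    qed
    then have "nabla ((?T ^^ k) f) j = nabla ((?T ^^ k) (\<lambda>i. f (i + s))) (j mod 2 ^ k)"
      unfolding funpow_mask_operator_shift by simp
    moreover have "norm (nabla (\<lambda>i. f (i + s)) i) \<le> d" for i
      using f[of "i + s"] by (simp add: nabla_def algebra_simps)
    ultimately show ?thesis
      using at_origin[of "\<lambda>i. f (i + s)" d "j mod 2 ^ k" k] by simp
  qed
  then show ?thesis using E0 by blast
qed

section \<open>Perturbed schemes\<close>

lemma linf_iff: "f \<in> linf \<longleftrightarrow> (\<exists>d. \<forall>i. norm (f i) \<le> d)"
  by (auto simp: linf_def bounded_iff)

lemma nabla_in_linf:
  assumes "f \<in> linf"
  shows "nabla f \<in> linf"
proof -
  obtain d where d: "\<And>i. norm (f i) \<le> d" using assms linf_iff by blast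
  have "norm (nabla f i) \<le> d + d" for i
    unfolding nabla_def using norm_triangle_ineq4[of "f (i + 1)" "f i"] d[of i] d[of "i + 1"]
    by linarith
  then show ?thesis using linf_iff by blast
qed

lemma mask_operator_in_linf: "f \<in> linf \<Longrightarrow> mask_operator p a f \<in> linf"
  using norm_mask_operator_le unfolding linf_iff by blast

lemma le_supnorm:
  assumes "is_norm N" "f \<in> linf"
  shows "N (f i) \<le> supnorm N f"
proof -
  obtain \<beta> where \<beta>: "\<beta> > 0" "\<And>x. N x \<le> \<beta> * norm x"
    using is_norm_equivalent[OF assms(1)] by blast
  obtain d where d: "\<And>i. norm (f i) \<le> d" using assms(2) linf_iff by blast
  have "N (f i) \<le> \<beta> * d" for i
    using \<beta>(2)[of "f i"] mult_left_mono[OF d[of i], of \<beta>] \<beta>(1) by linarith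
  then have "bdd_above (range (\<lambda>i. N (f i)))" by (rule bdd_aboveI2)
  then show ?thesis unfolding supnorm_def by (rule cSUP_upper2) auto
qed

lemma supnorm_le:
  assumes "\<And>i. N (f i) \<le> d"
  shows "supnorm N f \<le> d"
  unfolding supnorm_def using assms by (intro cSUP_least) auto

lemma is_norm_norm: "is_norm norm"
  by (auto simp: is_norm_def norm_triangle_ineq)

lemma compose_from_add:
  "compose_from S k (m + n) f = compose_from S (k + m) n (compose_from S k m f)"
  by (induction n) (simp_all add: add.assoc)

text \<open>Isolates the analysis from weights and parameters: a linear part whose differences decay
  at rate \<open>E\<close>, plus a correction of relative size \<open>(1 / 2) ^ k\<close>. The
  correction is not assumed linear; it enters estimates only through \<open>F_le\<close>.\<close>

locale perturbed_mask_scheme =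
  fixes p :: nat and a :: "int \<Rightarrow> nat \<Rightarrow> real"
    and S F :: "nat \<Rightarrow> (real ^ 'n) seqop" and M :: real and E :: "nat \<Rightarrow> real"
  assumes affine: "\<forall>l\<in>{0, 1}. (\<Sum>r<2 * p + 2. a l r) = 1"
    and maps: "maps_linf (S k)"
    and S_eq: "f \<in> linf \<Longrightarrow> S k f = (\<lambda>i. mask_operator p a f i + F k (nabla f) i)"
    and F_le: "(\<And>i. norm (\<delta> i) \<le> d) \<Longrightarrow> norm (F k \<delta> j) \<le> M * (1 / 2) ^ k * d"
    and M_nonneg: "0 \<le> M"
    and E_tendsto: "E \<longlonglongrightarrow> 0"
    and E_le: "(\<And>i. norm (nabla f i) \<le> d) \<Longrightarrow> norm (nabla ((mask_operator p a ^^ k) f) j) \<le> E k * d"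
begin

lemma compose_from_in_linf: "f \<in> linf \<Longrightarrow> compose_from S k m f \<in> linf"
  using maps by (induction m) (auto simp: maps_linf_def)

section \<open>Comparison with linear iterates and contraction of differences\<close>

text \<open>The constant may depend on the number \<open>m\<close> of steps but not on the starting
  level \<open>k\<close>. Each step passes the old error through the linear operator and adds one
  correction, whose argument is controlled because the linear iterate has controlled differences and
  the perturbed one stays near it.\<close>

lemma compose_from_close_to_funpow:
  "\<exists>c\<ge>0. \<forall>k f d. f \<in> linf \<longrightarrow> (\<forall>i. norm (nabla f i) \<le> d) \<longrightarrow>
     (\<forall>j. norm (compose_from S k m f j - (mask_operator p a ^^ m) f j) \<le> c * (1 / 2) ^ k * d)"
proof (induction m)
  case 0
  then show ?case by (intro exI[of _ 0]) simp
next
  case (Suc m)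
  then obtain c where c: "c \<ge> 0" and close: "\<And>k f d j. f \<in> linf \<Longrightarrow> (\<And>i. norm (nabla f i) \<le> d) \<Longrightarrow>
     norm (compose_from S k m f j - (mask_operator p a ^^ m) f j) \<le> c * (1 / 2) ^ k * d"
    by blast
  \<comment> \<open>The first summand propagates the old error, the second bounds the new
    correction. \<open>\<bar>E m\<bar> + 2 * c\<close> bounds the differences after \<open>m\<close>
    steps; the absolute value is there because \<open>E m\<close> may be negative.\<close>
  define c' where "c' = mask_bound p a * c + M * (\<bar>E m\<bar> + 2 * c)"
  have "norm (compose_from S k (Suc m) f j - (mask_operator p a ^^ Suc m) f j) \<le> c' * (1 / 2) ^ k * d"
    if f: "f \<in> linf" and d: "\<And>i. norm (nabla f i) \<le> d" for k f d j
  proof -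
    have d0: "0 \<le> d" using d[of 0] norm_ge_zero[of "nabla f 0"] by linarith
    define g h where "g = compose_from S k m f" and "h = (mask_operator p a ^^ m) f"
    have gh: "norm (g i - h i) \<le> c * (1 / 2) ^ k * d" for i
      unfolding g_def h_def by (rule close[OF f d])
    \<comment> \<open>For the differences of \<open>g\<close> the decay in \<open>k\<close> may be
      dropped, since the correction applied to them supplies its own factor.\<close>
    have "(1 / 2 :: real) ^ k \<le> 1" by (simp add: power_le_one)
    then have "c * (1 / 2) ^ k * d \<le> c * d"
      using c d0 by (intro mult_right_mono mult_left_le) auto
    then have gh': "norm (g i - h i) \<le> c * d" for i
      using gh[of i] by linarith
    have "norm (nabla g i) \<le> (\<bar>E m\<bar> + 2 * c) * d" for i
    proof -
      have "norm (nabla g i) = norm (nabla h i + (g (i + 1) - h (i + 1)) - (g i - h i))"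
        by (simp add: nabla_def)
      then have "norm (nabla g i) \<le> norm (nabla h i) + norm (g (i + 1) - h (i + 1)) + norm (g i - h i)"
        by (simp only: norm_add_diff_le)
      moreover have "norm (nabla h i) \<le> \<bar>E m\<bar> * d"
        unfolding h_def using E_le[of f d m i, OF d] mult_right_mono[OF abs_ge_self[of "E m"] d0]
        by linarith
      ultimately show ?thesis
        using gh'[of i] gh'[of "i + 1"] by (simp add: algebra_simps)
    qed
    then have "norm (F (k + m) (nabla g) j) \<le> M * (1 / 2) ^ (k + m) * ((\<bar>E m\<bar> + 2 * c) * d)"
      by (rule F_le)
    also have "\<dots> \<le> M * (1 / 2) ^ k * ((\<bar>E m\<bar> + 2 * c) * d)"
      using M_nonneg c d0 by (intro mult_right_mono mult_left_mono power_decreasing) auto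
    finally have "norm (F (k + m) (nabla g) j) \<le> M * (1 / 2) ^ k * ((\<bar>E m\<bar> + 2 * c) * d)" .
    moreover have "norm (mask_operator p a g j - mask_operator p a h j)
        \<le> mask_bound p a * (c * (1 / 2) ^ k * d)"
      unfolding mask_operator_diff by (rule norm_mask_operator_le) (rule gh)
    moreover have "g \<in> linf" unfolding g_def using f by (rule compose_from_in_linf)
    then have "norm (compose_from S k (Suc m) f j - (mask_operator p a ^^ Suc m) f j)
        = norm ((mask_operator p a g j - mask_operator p a h j) + F (k + m) (nabla g) j)"
      by (simp add: S_eq algebra_simps flip: g_def h_def)
    moreover have "c' * (1 / 2) ^ k * d
        = mask_bound p a * (c * (1 / 2) ^ k * d) + M * (1 / 2) ^ k * ((\<bar>E m\<bar> + 2 * c) * d)"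
      by (simp add: c'_def algebra_simps)
    ultimately show ?thesis
      using norm_triangle_ineq[of "mask_operator p a g j - mask_operator p a h j" "F (k + m) (nabla g) j"]
      by linarith
  qed
  moreover have "c' \<ge> 0"
    using c M_nonneg mask_bound_nonneg by (simp add: c'_def)
  ultimately show ?case by blast
qed

text \<open>Half of \<open>\<epsilon>\<close> is spent on the differences of the linear iterate, and
  a quarter on the deviation from it at each of the two neighbouring positions. The successor
  \<open>Suc K\<close> matches a product of operators with indices \<open>k\<close>, ...,
  \<open>k + K\<close>.\<close>

lemma nabla_compose_from_contracts:
  assumes "0 < \<epsilon>"
  shows "\<exists>K k0. \<forall>k\<ge>k0. \<forall>f\<in>linf. \<forall>d. (\<forall>i. norm (nabla f i) \<le> d) \<longrightarrow>
    (\<forall>j. norm (nabla (compose_from S k (Suc K) f) j) \<le> \<epsilon> * d)"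
proof -
  have "\<forall>\<^sub>F K in sequentially. E K < \<epsilon> / 2"
    using E_tendsto assms by (intro order_tendstoD) auto
  then obtain K0 where "\<And>K. K \<ge> K0 \<Longrightarrow> E K < \<epsilon> / 2"
    by (auto simp: eventually_sequentially)
  then have K: "E (Suc K0) < \<epsilon> / 2" by simp
  obtain c where close: "\<And>k f d j. f \<in> linf \<Longrightarrow> (\<And>i. norm (nabla f i) \<le> d) \<Longrightarrow>
     norm (compose_from S k (Suc K0) f j - (mask_operator p a ^^ Suc K0) f j) \<le> c * (1 / 2) ^ k * d"
    using compose_from_close_to_funpow[of "Suc K0"] by blast
  have "(\<lambda>k. c * (1 / 2) ^ k) \<longlonglongrightarrow> c * 0"
    by (intro tendsto_intros LIMSEQ_power_zero) auto
  then have "\<forall>\<^sub>F k in sequentially. c * (1 / 2) ^ k < \<epsilon> / 4"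
    using assms by (intro order_tendstoD) auto
  then obtain k0 where k0: "\<And>k. k \<ge> k0 \<Longrightarrow> c * (1 / 2) ^ k < \<epsilon> / 4"
    by (auto simp: eventually_sequentially)
  have "norm (nabla (compose_from S k (Suc K0) f) j) \<le> \<epsilon> * d"
    if k: "k \<ge> k0" and f: "f \<in> linf" and d: "\<And>i. norm (nabla f i) \<le> d" for k f d j
  proof -
    have d0: "0 \<le> d" using d[of 0] norm_ge_zero[of "nabla f 0"] by linarith
    define g h where "g = compose_from S k (Suc K0) f" and "h = (mask_operator p a ^^ Suc K0) f"
    have "c * (1 / 2) ^ k * d \<le> \<epsilon> / 4 * d"
      using k0[OF k] d0 by (intro mult_right_mono) auto
    then have gh: "norm (g i - h i) \<le> \<epsilon> / 4 * d" for i
      unfolding g_def h_def by (rule order_trans[OF close[OF f d]])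
    have "norm (nabla h j) \<le> E (Suc K0) * d"
      unfolding h_def by (rule E_le[OF d])
    also have "\<dots> \<le> \<epsilon> / 2 * d"
      using K d0 by (intro mult_right_mono) auto
    finally have "norm (nabla h j) \<le> \<epsilon> / 2 * d" .
    moreover have "norm (nabla g j) = norm (nabla h j + (g (j + 1) - h (j + 1)) - (g j - h j))"
      by (simp add: nabla_def)
    then have "norm (nabla g j) \<le> norm (nabla h j) + norm (g (j + 1) - h (j + 1)) + norm (g j - h j)"
      by (simp only: norm_add_diff_le)
    ultimately show ?thesis
      using gh[of j] gh[of "j + 1"] by (simp add: g_def)
  qed
  then show ?thesis by blast
qed

text \<open>Because each row sums to one, \<open>f (j div 2)\<close> can be subtracted inside the
  mask sum, and every index of the window lies within \<open>p + 1\<close> of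
  \<open>j div 2\<close>.\<close>

lemma refinement_close:
  assumes f: "f \<in> linf" and d: "\<And>i. norm (nabla f i) \<le> d"
  shows "norm (S k f j - f (j div 2)) \<le> (mask_bound p a * (real p + 1) + M) * d"
proof -
  have d0: "0 \<le> d" using d[of 0] norm_ge_zero[of "nabla f 0"] by linarith
  have "j mod 2 \<in> {0, 1}" by auto
  then have "(\<Sum>r<2 * p + 2. a (j mod 2) r) = 1" by (rule bspec[OF affine])
  then have "(\<Sum>r<2 * p + 2. a (j mod 2) r *\<^sub>R f (j div 2)) = f (j div 2)"
    by (simp only: scaleR_one flip: scaleR_sum_left)
  then have "mask_operator p a f j - f (j div 2)
      = (\<Sum>r<2 * p + 2. a (j mod 2) r *\<^sub>R (f (j div 2 - int p + int r) - f (j div 2)))"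
    by (simp only: mask_operator_def scaleR_diff_right sum_subtractf)
  also have "norm \<dots> \<le> mask_bound p a * ((real p + 1) * d)"
  proof (rule norm_mask_sum_le)
    fix r assume "r < 2 * p + 2"
    then have "\<bar>real_of_int (j div 2 - int p + int r - j div 2)\<bar> \<le> real p + 1"
      by (simp add: abs_le_iff)
    then show "norm (f (j div 2 - int p + int r) - f (j div 2)) \<le> (real p + 1) * d"
      using norm_diff_le_of_nabla[of f d, OF d] mult_right_mono[OF _ d0] order_trans by blast
  qed
  finally have "norm (mask_operator p a f j - f (j div 2)) \<le> mask_bound p a * ((real p + 1) * d)" .
  moreover have "norm (F k (nabla f) j) \<le> M * d"
  proof -
    have "(1 / 2 :: real) ^ k \<le> 1" by (simp add: power_le_one)
    then have "M * (1 / 2) ^ k * d \<le> M * d"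
      using M_nonneg d0 by (intro mult_right_mono mult_left_le) auto
    then show ?thesis using F_le[of "nabla f" d k j, OF d] by linarith
  qed
  moreover have "norm (S k f j - f (j div 2))
      = norm ((mask_operator p a f j - f (j div 2)) + F k (nabla f) j)"
    by (simp add: S_eq[OF f] algebra_simps)
  moreover have "(mask_bound p a * (real p + 1) + M) * d = mask_bound p a * ((real p + 1) * d) + M * d"
    by (simp add: algebra_simps)
  ultimately show ?thesis
    using norm_triangle_ineq[of "mask_operator p a f j - f (j div 2)" "F k (nabla f) j"] by linarith
qed

lemma dyadic_limit:
  assumes f: "f \<in> linf"
  shows "\<exists>G. continuous_on UNIV G \<and>
    (\<exists>\<tau>. \<tau> \<longlonglongrightarrow> 0 \<and> (\<forall>k i. norm (compose_from S 0 k f i - G (real_of_int i / 2 ^ k)) \<le> \<tau> k))"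
proof -
  define g where "g k = compose_from S 0 k f" for k
  define u where "u k = supnorm norm (nabla (g k))" for k
  have g: "g k \<in> linf" for k unfolding g_def using f by (rule compose_from_in_linf)
  have step: "norm (nabla (g k) i) \<le> u k" for k i
    unfolding u_def by (rule le_supnorm[OF is_norm_norm nabla_in_linf[OF g]])
  obtain K k0 where contr: "\<And>k f d (j :: int). k \<ge> k0 \<Longrightarrow> f \<in> linf \<Longrightarrow> (\<And>i. norm (nabla f i) \<le> d) \<Longrightarrow>
      norm (nabla (compose_from S k (Suc K) f) j) \<le> 1 / 2 * d"
    using nabla_compose_from_contracts[of "1 / 2"] by fastforce
  have "summable u"
  proof (rule summable_if_delayed_contraction)
    show "0 \<le> u k" for k
      using step[of k 0] norm_ge_zero order_trans by blast
    show "u (k + Suc K) \<le> 1 / 2 * u k" if "k0 \<le> k" for k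
    proof -
      have "g (k + Suc K) = compose_from S k (Suc K) (g k)"
        unfolding g_def using compose_from_add[of S 0 k "Suc K" f] by simp
      then show ?thesis
        unfolding u_def[of "k + Suc K"] using contr[OF that g step] by (intro supnorm_le) simp
    qed
  qed auto
  moreover have "norm (g (Suc k) j - g k (j div 2)) \<le> (mask_bound p a * (real p + 1) + M) * u k" for k j
    using refinement_close[OF g[of k] step[of k], where k = k and j = j] by (simp add: g_def)
  moreover have "norm (g k (i + 1) - g k i) \<le> u k" for k i
    using step[of k i] by (simp add: nabla_def)
  ultimately show ?thesis
    unfolding g_def[symmetric] by (intro dyadic_limit_exists)
qed

lemma F_maps_linf: "maps_linf (F k)"
  unfolding maps_linf_def
proof
  fix \<delta> :: "int \<Rightarrow> real ^ 'n"
  assume "\<delta> \<in> linf"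
  then obtain d where "\<And>i. norm (\<delta> i) \<le> d" using linf_iff by blast
  then have "norm (F k \<delta> j) \<le> M * (1 / 2) ^ k * d" for j by (rule F_le)
  then show "F k \<delta> \<in> linf" using linf_iff by blast
qed

section \<open>Transfer of the estimates to the given norm\<close>

lemma supnorm_F_le:
  assumes N: "is_norm N"
  shows "\<exists>M'>0. \<forall>k. \<forall>\<delta>\<in>linf. supnorm N (F k \<delta>) \<le> M' * supnorm N \<delta>"
proof -
  obtain \<alpha> \<beta> where \<alpha>: "\<alpha> > 0" "\<And>x. norm x \<le> \<alpha> * N x" and \<beta>: "\<beta> > 0" "\<And>x. N x \<le> \<beta> * norm x"
    using is_norm_equivalent[OF N] by blast
  \<comment> \<open>The factors \<open>\<alpha>\<close> and \<open>\<beta>\<close> pay for changing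
    the norm on both sides; \<open>M + 1\<close> in place of \<open>M\<close> keeps the constant
    positive even when \<open>M = 0\<close>.\<close>
  have "supnorm N (F k \<delta>) \<le> (\<beta> * (M + 1) * \<alpha>) * supnorm N \<delta>" if \<delta>: "\<delta> \<in> linf" for k \<delta>
  proof (rule supnorm_le)
    fix j
    let ?s = "supnorm N \<delta>"
    have d: "norm (\<delta> i) \<le> \<alpha> * ?s" for i
      using \<alpha>(2)[of "\<delta> i"] mult_left_mono[OF le_supnorm[OF N \<delta>, of i], of \<alpha>] \<alpha>(1) by linarith
    then have d0: "0 \<le> \<alpha> * ?s" using norm_ge_zero order_trans by blast
    have "norm (F k \<delta> j) \<le> M * (1 / 2) ^ k * (\<alpha> * ?s)"
      by (rule F_le) (rule d)
    also have "\<dots> \<le> (M + 1) * (\<alpha> * ?s)"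
      using M_nonneg d0 by (intro mult_right_mono order_trans[OF mult_left_le]) (auto simp: power_le_one)
    finally have "\<beta> * norm (F k \<delta> j) \<le> \<beta> * ((M + 1) * (\<alpha> * ?s))"
      using \<beta>(1) by (intro mult_left_mono) auto
    then show "N (F k \<delta> j) \<le> (\<beta> * (M + 1) * \<alpha>) * ?s"
      using \<beta>(2)[of "F k \<delta> j"] by (simp only: mult.assoc)
  qed
  moreover have "\<beta> * (M + 1) * \<alpha> > 0" using \<alpha> \<beta> M_nonneg by simp
  ultimately show ?thesis by blast
qed

lemma supnorm_nabla_contracts:
  assumes N: "is_norm N"
  shows "\<exists>K k0. \<forall>k\<ge>k0. \<forall>f\<in>linf.
    supnorm N (nabla (compose_from S k (Suc K) f)) \<le> 1 / 2 * supnorm N (nabla f)"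
proof -
  obtain \<alpha> \<beta> where \<alpha>: "\<alpha> > 0" "\<And>x. norm x \<le> \<alpha> * N x" and \<beta>: "\<beta> > 0" "\<And>x. N x \<le> \<beta> * norm x"
    using is_norm_equivalent[OF N] by blast
  \<comment> \<open>Chosen so that \<open>\<beta> * \<epsilon> * \<alpha> = 1 / 2\<close>: the
    Euclidean contraction must outweigh both changes of norm.\<close>
  define \<epsilon> where "\<epsilon> = 1 / (2 * \<alpha> * \<beta>)"
  have "\<epsilon> > 0" using \<alpha> \<beta> by (simp add: \<epsilon>_def)
  then obtain K k0 where contr: "\<And>k f d (j :: int). k \<ge> k0 \<Longrightarrow> f \<in> linf \<Longrightarrow> (\<And>i. norm (nabla f i) \<le> d) \<Longrightarrow>
      norm (nabla (compose_from S k (Suc K) f) j) \<le> \<epsilon> * d"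
    using nabla_compose_from_contracts by metis
  have "supnorm N (nabla (compose_from S k (Suc K) f)) \<le> 1 / 2 * supnorm N (nabla f)"
    if k: "k \<ge> k0" and f: "f \<in> linf" for k f
  proof (rule supnorm_le)
    fix j
    let ?s = "supnorm N (nabla f)" and ?g = "nabla (compose_from S k (Suc K) f)"
    have "norm (nabla f i) \<le> \<alpha> * ?s" for i
      using \<alpha>(2)[of "nabla f i"] mult_left_mono[OF le_supnorm[OF N nabla_in_linf[OF f], of i], of \<alpha>] \<alpha>(1)
      by linarith
    then have "norm (?g j) \<le> \<epsilon> * (\<alpha> * ?s)"
      by (rule contr[OF k f])
    then have "\<beta> * norm (?g j) \<le> \<beta> * (\<epsilon> * (\<alpha> * ?s))"
      using \<beta>(1) by (intro mult_left_mono) auto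
    also have "\<dots> = 1 / 2 * ?s"
      using \<alpha>(1) \<beta>(1) by (simp add: \<epsilon>_def field_simps)
    finally show "N (?g j) \<le> 1 / 2 * ?s"
      using \<beta>(2) order_trans by blast
  qed
  then show ?thesis by blast
qed

text \<open>Serves to show that the limit operator is nonzero. A constant sequence has zero
  differences, so \<open>F_le\<close> with bound 0 removes the correction, and unit row sums let the
  linear part keep the constant.\<close>

lemma compose_from_const_seq: "compose_from S k m (\<lambda>_. v) = (\<lambda>_. v)"
proof (induction m)
  case (Suc m)
  have const: "(\<lambda>_. v) \<in> linf" unfolding linf_iff by blast
  have "F k' (nabla (\<lambda>_. v)) j = 0" for k' j
    using F_le[of "nabla (\<lambda>_. v)" 0 k' j] by (simp add: nabla_def)
  moreover have "mask_operator p a (\<lambda>_. v) = (\<lambda>_. v)"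
    using mask_operator_add_const[OF affine, of "\<lambda>_. 0" v] by (simp add: mask_operator_def)
  ultimately show ?case using Suc by (simp add: S_eq[OF const])
qed simp

lemma convergent:
  assumes N: "is_norm N"
  shows "convergent_scheme N S"
proof -
  obtain Sinf where cont: "\<And>f. f \<in> linf \<Longrightarrow> continuous_on UNIV (Sinf f)"
    and lim: "\<And>f. f \<in> linf \<Longrightarrow> \<exists>\<tau>. \<tau> \<longlonglongrightarrow> 0 \<and>
      (\<forall>k i. norm (compose_from S 0 k f i - Sinf f (real_of_int i / 2 ^ k)) \<le> \<tau> k)"
    using dyadic_limit by metis
  obtain \<beta> where \<beta>: "\<beta> > 0" "\<And>x. N x \<le> \<beta> * norm x"
    using is_norm_equivalent[OF N] by blast
  have "converges_uniformly N (\<lambda>k. compose_from S 0 k f) (Sinf f)" if f: "f \<in> linf" for f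
    unfolding converges_uniformly_def
  proof (intro allI)
    fix s t :: real
    obtain \<tau> where \<tau>: "\<tau> \<longlonglongrightarrow> 0"
      "\<And>k i. norm (compose_from S 0 k f i - Sinf f (real_of_int i / 2 ^ k)) \<le> \<tau> k"
      using lim[OF f] by blast
    have "(\<lambda>k. ennreal (\<beta> * \<tau> k)) \<longlonglongrightarrow> ennreal (\<beta> * 0)"
      by (intro tendsto_ennrealI tendsto_intros \<tau>(1))
    then have upper: "(\<lambda>k. ennreal (\<beta> * \<tau> k)) \<longlonglongrightarrow> 0" by simp
    have "N (compose_from S 0 k f i - Sinf f (real_of_int i / 2 ^ k)) \<le> \<beta> * \<tau> k" for k i
      using \<beta>(2) mult_left_mono[OF \<tau>(2)[of k i], of \<beta>] \<beta>(1) by (meson less_imp_le order_trans)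
    then have "(SUP i\<in>{i. real_of_int i / 2 ^ k \<in> {s..t}}.
        ennreal (N (compose_from S 0 k f i - Sinf f (real_of_int i / 2 ^ k)))) \<le> ennreal (\<beta> * \<tau> k)" for k
      by (intro SUP_least ennreal_leI)
    then show "(\<lambda>k. SUP i\<in>{i. real_of_int i / 2 ^ k \<in> {s..t}}.
        ennreal (N (compose_from S 0 k f i - Sinf f (real_of_int i / 2 ^ k)))) \<longlonglongrightarrow> 0"
      by (intro tendsto_sandwich[OF _ _ tendsto_const upper] always_eventually allI) auto
  qed
  moreover have "\<exists>f\<in>linf. \<exists>t. Sinf f t \<noteq> 0"
  proof -
    obtain v :: "real ^ 'n" where v: "norm v = 1" using vector_choose_size[of 1] by auto
    have const: "(\<lambda>_. v) \<in> linf" unfolding linf_iff by blast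
    obtain \<tau> where \<tau>: "\<tau> \<longlonglongrightarrow> 0"
      "\<And>k i. norm (compose_from S 0 k (\<lambda>_. v) i - Sinf (\<lambda>_. v) (real_of_int i / 2 ^ k)) \<le> \<tau> k"
      using lim[OF const] by blast
    have "norm (v - Sinf (\<lambda>_. v) 0) \<le> \<tau> k" for k
      using \<tau>(2)[of k 0] by (simp add: compose_from_const_seq)
    then have "norm (v - Sinf (\<lambda>_. v) 0) \<le> 0"
      by (intro LIMSEQ_le_const[OF \<tau>(1)]) auto
    then have "Sinf (\<lambda>_. v) 0 = v" by simp
    moreover have "v \<noteq> 0" using v by auto
    ultimately show ?thesis using const by metis
  qed
  ultimately show ?thesis unfolding convergent_scheme_def using cont by blast
qed

end

section \<open>Class B\<close>

text \<open>A discrete antiderivative starting at zero, hence a right inverse of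
  \<open>tuple_diff\<close>: it recovers a window of data from its differences up to an additive
  constant.\<close>

definition partial_sums :: "'v::ab_group_add list \<Rightarrow> 'v list" where
  "partial_sums w = map (\<lambda>r. \<Sum>s<r. w ! s) [0..<Suc (length w)]"

lemma length_partial_sums [simp]: "length (partial_sums w) = Suc (length w)"
  by (simp add: partial_sums_def)

lemma nth_partial_sums: "r \<le> length w \<Longrightarrow> partial_sums w ! r = (\<Sum>s<r. w ! s)"
  by (simp add: partial_sums_def del: upt_Suc)

lemma nth_tuple_diff:
  assumes "Suc r < length x"
  shows "tuple_diff x ! r = x ! Suc r - x ! r"
  using assms by (simp add: tuple_diff_def nth_tl)

lemma length_tuple_diff [simp]: "length (tuple_diff x) = length x - 1"
  by (simp add: tuple_diff_def)

lemma tuple_diff_partial_sums: "tuple_diff (partial_sums w) = w"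
  by (rule nth_equalityI) (simp_all add: nth_tuple_diff nth_partial_sums sum.lessThan_Suc)

definition diff_window :: "nat \<Rightarrow> (int \<Rightarrow> 'v) \<Rightarrow> int \<Rightarrow> 'v list" where
  "diff_window p \<delta> i = map \<delta> [i - int p..i + int p]"

lemma length_diff_window [simp]: "length (diff_window p \<delta> i) = 2 * p + 1"
  by (simp add: diff_window_def)

lemma nth_diff_window:
  assumes "r < 2 * p + 1"
  shows "diff_window p \<delta> i ! r = \<delta> (i - int p + int r)"
proof -
  have "[i - int p..i + int p] ! r = i - int p + int r"
    using assms by (intro nth_upto) auto
  then show ?thesis using assms by (simp add: diff_window_def)
qed

lemma tuple_diff_window: "tuple_diff (window p f i) = diff_window p (nabla f) i"
  by (rule nth_equalityI)
    (simp_all add: nth_tuple_diff nth_window nth_diff_window nabla_def algebra_simps)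

lemma nth_window_eq_partial_sums:
  assumes "r < 2 * p + 2"
  shows "window p f i ! r = f (i - int p) + partial_sums (diff_window p (nabla f) i) ! r"
proof -
  have "f (i - int p + int r) = f (i - int p) + (\<Sum>s<r. nabla f (i - int p + int s))" for r
    by (induction r) (simp_all add: sum.lessThan_Suc nabla_def algebra_simps)
  moreover have "partial_sums (diff_window p (nabla f) i) ! r = (\<Sum>s<r. nabla f (i - int p + int s))"
    using assms by (simp add: nth_partial_sums nth_diff_window)
  ultimately show ?thesis using assms by (simp add: nth_window)
qed

lemma norm_partial_sums_diff_window_le:
  fixes \<delta> :: "int \<Rightarrow> real ^ 'n"
  assumes "\<And>i. norm (\<delta> i) \<le> d" and r: "r < 2 * p + 2"
  shows "norm (partial_sums (diff_window p \<delta> i) ! r) \<le> real (2 * p + 2) * d"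
proof -
  have d: "0 \<le> d" using assms(1)[of 0] norm_ge_zero[of "\<delta> 0"] by linarith
  have "norm (\<Sum>s<r. diff_window p \<delta> i ! s) \<le> (\<Sum>s<r. d)"
    using assms by (intro sum_norm_le) (simp add: nth_diff_window)
  also have "\<dots> \<le> real (2 * p + 2) * d"
    using r d by (simp add: mult_right_mono)
  finally show ?thesis using r by (simp add: nth_partial_sums)
qed

text \<open>Since the weights in \<open>\<Lambda>\<close> and \<open>\<Lambda> 0\<close> have the same sum, their difference sees the data only up to
  an additive constant, so the partial sums of the differences can replace the data. In this form
  the correction also makes sense for bounded sequences \<open>\<delta>\<close> that are not of the form \<open>nabla f\<close>
  with bounded \<open>f\<close>.\<close>

definition correction ::
  "nat \<Rightarrow> (int \<Rightarrow> real ^ 'q \<Rightarrow> real list) \<Rightarrow> (nat \<Rightarrow> (real ^ 'n) list \<Rightarrow> real ^ 'q) \<Rightarrow>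
    nat \<Rightarrow> (real ^ 'n) seqop" where
  "correction p \<Lambda> \<pi>1 k \<delta> j =
     (let w = diff_window p \<delta> (j div 2); l = j mod 2
      in pairing (map2 (-) (\<Lambda> l (\<pi>1 k w)) (\<Lambda> l 0)) (partial_sums w))"

lemma stationary_scheme_uniform_operator:
  fixes \<psi> :: "int \<Rightarrow> (real ^ 'n) list \<Rightarrow> real ^ 'n"
  assumes "maps_linf (uniform_operator p \<psi>)"
  shows "stationary_scheme (\<lambda>_. uniform_operator p \<psi>)"
  unfolding stationary_scheme_def has_uniform_rules_def
  using assms by (intro exI[of _ p] exI[of _ \<psi>]) (auto simp: uniform_operator_def)

lemma linear_rule_pairing:
  assumes "length a = m"
  shows "linear_rule m (pairing a :: (real ^ 'n) list \<Rightarrow> real ^ 'n)"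
  using assms unfolding linear_rule_def
  by (auto simp: pairing_eq_sum[of _ m] scaleR_add_right sum.distrib scaleR_sum_right mult.commute)

lemma linear_subdivision_operator_uniform_operator:
  fixes \<psi> :: "int \<Rightarrow> (real ^ 'n) list \<Rightarrow> real ^ 'n"
  assumes "maps_linf (uniform_operator p \<psi>)" and "\<And>l. l \<in> {0, 1} \<Longrightarrow> linear_rule (2 * p + 2) (\<psi> l)"
  shows "linear_subdivision_operator (uniform_operator p \<psi>)"
proof -
  have "linear_rule (2 * p + 2) (\<psi> (j mod 2))" for j
    by (rule assms(2)) auto
  then show ?thesis
    unfolding linear_subdivision_operator_def using assms(1)
    by (intro conjI exI[of _ p] exI[of _ "\<lambda>j. \<psi> (j mod 2)"]) (auto simp: uniform_operator_def)
qed

lemma class_B_perturbed_mask_scheme: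
  fixes N :: "real ^ 'n \<Rightarrow> real"
    and S :: "nat \<Rightarrow> (real ^ 'n) seqop"
    and \<pi> \<pi>1 :: "nat \<Rightarrow> (real ^ 'n) list \<Rightarrow> real ^ 'q"
  assumes N: "is_norm N"
    and B: "class_B N p D \<pi> \<Lambda> \<rho> C S"
    and affine: "\<forall>l\<in>{0, 1}. \<forall>v\<in>D. pairing (\<Lambda> l v) (replicate (2 * p + 2) (1::real)) = 1"
    and \<pi>1: "\<forall>k x. length x = 2 * p + 2 \<longrightarrow> \<pi> k x = \<pi>1 k (tuple_diff x)"
  shows "\<exists>M E. perturbed_mask_scheme p (\<lambda>l r. \<Lambda> l 0 ! r) S (correction p \<Lambda> \<pi>1) M E"
proof -
  let ?a = "\<lambda>l r. \<Lambda> l 0 ! r"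
  let ?m = "2 * p + 2"
  have D0: "0 \<in> D" and \<rho>: "\<rho> > 0" and C: "C > 0"
    and \<pi>_D: "\<And>k x. length x = ?m \<Longrightarrow> \<pi> k x \<in> D"
    and len: "\<And>l v. l \<in> {0, 1} \<Longrightarrow> v \<in> D \<Longrightarrow> length (\<Lambda> l v) = ?m"
    and S: "has_uniform_rules p (\<lambda>k l x. pairing (\<Lambda> l (\<pi> k x)) x) S"
    and T: "convergent_scheme N (\<lambda>k. uniform_operator p (\<lambda>l x. pairing (\<Lambda> l 0) x))"
    using B unfolding class_B_def by auto
  obtain Nq :: "real ^ 'q \<Rightarrow> real" and Nm where Nm: "is_tuple_norm ?m Nm"
    and \<pi>_le: "\<And>k x. length x = ?m \<Longrightarrow> Nq (\<pi> k x) \<le> 2 powi (- int k) * \<rho>"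
    and \<Lambda>_le: "\<And>l v. l \<in> {0, 1} \<Longrightarrow> v \<in> D \<Longrightarrow> Nm (map2 (-) (\<Lambda> l v) (\<Lambda> l 0)) \<le> C * Nq v"
    using B unfolding class_B_def by blast
  obtain \<kappa> where \<kappa>: "\<kappa> > 0" "\<And>x j. length x = ?m \<Longrightarrow> j < ?m \<Longrightarrow> \<bar>x ! j\<bar> \<le> \<kappa> * Nm x"
    using tuple_norm_bounds_coordinates[OF Nm] by blast
  have sum1: "(\<Sum>r<?m. \<Lambda> l v ! r) = 1" if "l \<in> {0, 1}" "v \<in> D" for l v
  proof -
    have "pairing (\<Lambda> l v) (replicate ?m (1::real)) = (\<Sum>r<?m. \<Lambda> l v ! r)"
      unfolding pairing_eq_sum[OF len[OF that] length_replicate]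
      by (rule sum.cong[OF refl]) (simp only: lessThan_iff nth_replicate real_scaleR_def mult_1_right)
    moreover have "pairing (\<Lambda> l v) (replicate ?m (1::real)) = 1"
      using affine that by blast
    ultimately show ?thesis by (simp only:)
  qed
  have T_eq: "uniform_operator p (\<lambda>l x. pairing (\<Lambda> l 0) x)
      = (mask_operator p ?a :: (int \<Rightarrow> real ^ 'n) \<Rightarrow> _)"
    by (rule uniform_operator_eq_mask_operator) (rule len[OF _ D0])
  have affine0: "\<forall>l\<in>{0, 1}. (\<Sum>r<?m. ?a l r) = 1" using sum1[OF _ D0] by blast
  obtain E where E: "E \<longlonglongrightarrow> 0"
    "\<And>k (f :: int \<Rightarrow> real ^ 'n) d j. (\<And>i. norm (nabla f i) \<le> d) \<Longrightarrow>
       norm (nabla ((mask_operator p ?a ^^ k) f) j) \<le> E k * d"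
    using nabla_funpow_mask_operator_tendsto_zero[OF N _ affine0] T unfolding T_eq by metis
  \<comment> \<open>The estimates on \<open>\<pi>\<close> concern tuples of data, whereas
    \<open>correction\<close> evaluates \<open>\<pi>1\<close> at arbitrary tuples of differences.
    Each of these is the difference of its own partial sums, so the estimates carry over.\<close>
  have \<pi>1_eq: "\<pi>1 k w = \<pi> k (partial_sums w)" if "length w = 2 * p + 1" for k w
    using \<pi>1 that by (simp add: tuple_diff_partial_sums)
  \<comment> \<open>One factor \<open>real ?m\<close> counts the terms of the pairing and the other
    bounds the partial sums; \<open>\<kappa> * (C * \<rho>)\<close> bounds each change of weight
    apart from \<open>(1 / 2) ^ k\<close>.\<close>
  define M where "M = real ?m * (\<kappa> * (C * \<rho>)) * real ?m"
  have weights_le: "\<bar>\<Lambda> l (\<pi> k x) ! r - \<Lambda> l 0 ! r\<bar> \<le> \<kappa> * (C * \<rho>) * (1 / 2) ^ k"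
    if l: "l \<in> {0, 1}" and x: "length x = ?m" and r: "r < ?m" for l k x r
  proof -
    let ?d = "map2 (-) (\<Lambda> l (\<pi> k x)) (\<Lambda> l 0)"
    have ls: "length (\<Lambda> l (\<pi> k x)) = ?m" "length (\<Lambda> l 0) = ?m"
      using len[OF l] \<pi>_D[OF x] D0 by auto
    then have "\<bar>?d ! r\<bar> \<le> \<kappa> * Nm ?d" using r by (intro \<kappa>(2)) auto
    also have "\<dots> \<le> \<kappa> * (C * (2 powi (- int k) * \<rho>))"
      using \<Lambda>_le[OF l \<pi>_D[OF x], of k] \<pi>_le[OF x, of k] \<kappa>(1) C
      by (meson mult_left_mono order_trans less_imp_le)
    also have "\<dots> = \<kappa> * (C * \<rho>) * (1 / 2) ^ k"
      by (simp add: power_int_minus power_one_over field_simps)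
    finally show ?thesis using ls r by simp
  qed
  have correction_eq: "correction p \<Lambda> \<pi>1 k \<delta> j = (\<Sum>r<?m. (\<Lambda> l (\<pi> k x) ! r - \<Lambda> l 0 ! r) *\<^sub>R x ! r)"
    if "l = j mod 2" "x = partial_sums (diff_window p \<delta> (j div 2))" for k \<delta> j l x
  proof -
    have l: "l \<in> {0, 1}" using that(1) by auto
    have x: "length x = ?m" using that(2) by simp
    have ls: "length (\<Lambda> l (\<pi> k x)) = ?m" "length (\<Lambda> l 0) = ?m"
      using len[OF l] \<pi>_D[OF x] D0 by auto
    have "correction p \<Lambda> \<pi>1 k \<delta> j = pairing (map2 (-) (\<Lambda> l (\<pi> k x)) (\<Lambda> l 0)) x"
      unfolding correction_def Let_def that by (simp add: \<pi>1_eq)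
    also have "\<dots> = (\<Sum>r<?m. (\<Lambda> l (\<pi> k x) ! r - \<Lambda> l 0 ! r) *\<^sub>R x ! r)"
      using ls x by (subst pairing_eq_sum[of _ ?m]) (auto intro: sum.cong)
    finally show ?thesis .
  qed
  have "perturbed_mask_scheme p ?a S (correction p \<Lambda> \<pi>1) M E"
  proof
    show "\<forall>l\<in>{0, 1}. (\<Sum>r<?m. ?a l r) = 1" by (rule affine0)
    show "maps_linf (S k)" for k using S by (simp add: has_uniform_rules_def)
    show "0 \<le> M" using \<kappa> C \<rho> by (simp add: M_def)
    show "E \<longlonglongrightarrow> 0" by (rule E(1))
    show "norm (nabla ((mask_operator p ?a ^^ k) f) j) \<le> E k * d"
      if "\<And>i. norm (nabla f i) \<le> d" for f :: "int \<Rightarrow> real ^ 'n" and d k j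
      using that by (rule E(2))
    show "norm (correction p \<Lambda> \<pi>1 k \<delta> j) \<le> M * (1 / 2) ^ k * d"
      if \<delta>: "\<And>i. norm (\<delta> i) \<le> d" for \<delta> :: "int \<Rightarrow> real ^ 'n" and d k j
    proof -
      define x where "x = partial_sums (diff_window p \<delta> (j div 2))"
      have "norm (correction p \<Lambda> \<pi>1 k \<delta> j)
          = norm (\<Sum>r<?m. (\<Lambda> (j mod 2) (\<pi> k x) ! r - \<Lambda> (j mod 2) 0 ! r) *\<^sub>R x ! r)"
        by (subst correction_eq[OF refl x_def]) (rule refl)
      also have "\<dots> \<le> (\<Sum>r<?m. (\<kappa> * (C * \<rho>) * (1 / 2) ^ k) * (real ?m * d))"
      proof (rule sum_norm_le)
        fix r assume "r \<in> {..<?m}"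
        then have "\<bar>\<Lambda> (j mod 2) (\<pi> k x) ! r - \<Lambda> (j mod 2) 0 ! r\<bar> \<le> \<kappa> * (C * \<rho>) * (1 / 2) ^ k"
          "norm (x ! r) \<le> real ?m * d"
          unfolding x_def by (intro weights_le norm_partial_sums_diff_window_le[OF \<delta>]; force)+
        then show "norm ((\<Lambda> (j mod 2) (\<pi> k x) ! r - \<Lambda> (j mod 2) 0 ! r) *\<^sub>R x ! r)
            \<le> (\<kappa> * (C * \<rho>) * (1 / 2) ^ k) * (real ?m * d)"
          using \<kappa>(1) C \<rho> unfolding norm_scaleR by (intro mult_mono) auto
      qed
      also have "\<dots> = M * (1 / 2) ^ k * d"
        by (simp only: M_def sum_constant card_lessThan mult_ac)
      finally show ?thesis .
    qed
    show "S k f = (\<lambda>j. mask_operator p ?a f j + correction p \<Lambda> \<pi>1 k (nabla f) j)"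
      if f: "f \<in> linf" for k f
    proof
      fix j :: int
      define l i where "l = j mod 2" and "i = j div 2"
      define y x where "y = window p f i" and "x = partial_sums (diff_window p (nabla f) i)"
      have l: "l \<in> {0, 1}" unfolding l_def by auto
      have x: "length x = ?m" by (simp add: x_def)
      \<comment> \<open>The data window \<open>y\<close> and the partial sums \<open>x\<close> have
        the same differences, and \<open>\<pi> k\<close> depends on nothing else.\<close>
      have "\<pi> k y = \<pi> k x"
        using \<pi>1 by (simp add: y_def x_def tuple_diff_window tuple_diff_partial_sums)
      have y_nth: "y ! r = f (i - int p) + x ! r" if "r < ?m" for r
        unfolding y_def x_def using that by (rule nth_window_eq_partial_sums)
      let ?b = "\<lambda>r. \<Lambda> l (\<pi> k x) ! r"
      have "(\<Sum>r<?m. (?b r - ?a l r) *\<^sub>R y ! r)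
          = (\<Sum>r<?m. (?b r - ?a l r) *\<^sub>R f (i - int p) + (?b r - ?a l r) *\<^sub>R x ! r)"
        by (intro sum.cong) (auto simp: y_nth scaleR_add_right)
      also have "\<dots> = (\<Sum>r<?m. ?b r - ?a l r) *\<^sub>R f (i - int p) + (\<Sum>r<?m. (?b r - ?a l r) *\<^sub>R x ! r)"
        by (simp only: sum.distrib scaleR_sum_left)
      \<comment> \<open>Both rows of weights sum to one, so the additive constant separating
        \<open>y\<close> from \<open>x\<close> cancels.\<close>
      also have "(\<Sum>r<?m. ?b r - ?a l r) = 0"
        using sum1[OF l \<pi>_D[OF x]] sum1[OF l D0] by (simp only: sum_subtractf diff_self)
      finally have corr: "correction p \<Lambda> \<pi>1 k (nabla f) j = (\<Sum>r<?m. (?b r - ?a l r) *\<^sub>R y ! r)"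
        using correction_eq[OF l_def x_def[unfolded i_def], of k] by simp
      have mask: "mask_operator p ?a f j = (\<Sum>r<?m. ?a l r *\<^sub>R y ! r)"
        unfolding mask_operator_def l_def y_def i_def by (intro sum.cong) (auto simp: nth_window)
      have "S k f (2 * i + l) = pairing (\<Lambda> l (\<pi> k y)) y"
        using S f l unfolding has_uniform_rules_def y_def by blast
      then have "S k f j = pairing (\<Lambda> l (\<pi> k x)) y"
        by (simp add: \<open>\<pi> k y = \<pi> k x\<close> i_def l_def)
      also have "\<dots> = (\<Sum>r<?m. ?b r *\<^sub>R y ! r)"
        using len[OF l \<pi>_D[OF x]] by (intro pairing_eq_sum) (auto simp: y_def)
      also have "\<dots> = mask_operator p ?a f j + correction p \<Lambda> \<pi>1 k (nabla f) j"
        unfolding corr mask by (simp only: scaleR_diff_left sum_subtractf) simp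
      finally show "S k f j = mask_operator p ?a f j + correction p \<Lambda> \<pi>1 k (nabla f) j" .
    qed
  qed
  then show ?thesis by blast
qed

theorem theorem36:
  fixes N :: "real ^ 'n \<Rightarrow> real"
    and S :: "nat \<Rightarrow> (real ^ 'n) seqop"
    and p :: nat
    and D :: "(real ^ 'q) set"
    and \<pi> :: "nat \<Rightarrow> (real ^ 'n) list \<Rightarrow> real ^ 'q"
    and \<pi>1 :: "nat \<Rightarrow> (real ^ 'n) list \<Rightarrow> real ^ 'q"
    and \<Lambda> :: "int \<Rightarrow> real ^ 'q \<Rightarrow> real list"
    and \<rho> C :: real
  assumes "is_norm N"
    and "class_B N p D \<pi> \<Lambda> \<rho> C S"
    and "\<forall>l\<in>{0, 1}. \<forall>v\<in>D. pairing (\<Lambda> l v) (replicate (2 * p + 2) (1::real)) = 1"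
    and "\<forall>k d. length d = 2 * p + 1 \<longrightarrow> \<pi>1 k d \<in> D"
    and "\<forall>k x. length x = 2 * p + 2 \<longrightarrow> \<pi> k x = \<pi>1 k (tuple_diff x)"
  shows "(\<exists>(T :: (real ^ 'n) seqop) (F :: nat \<Rightarrow> (real ^ 'n) seqop).
            linear_subdivision_operator T \<and>
            stationary_scheme (\<lambda>k. T) \<and>
            convergent_scheme N (\<lambda>k. T) \<and>
            (\<forall>k. maps_linf (F k)) \<and>
            (\<forall>k. \<forall>f\<in>linf. S k f = (\<lambda>i. T f i + F k (nabla f) i)) \<and>
            (\<exists>M>0. \<exists>c\<in>{0<..<1}. \<exists>k0 K. \<forall>k\<ge>k0.
               (\<forall>\<delta>\<in>linf. supnorm N (F k \<delta>) \<le> M * supnorm N \<delta>) \<and>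
               (\<forall>f\<in>linf. supnorm N (nabla (compose_from S k (Suc K) f)) \<le> c * supnorm N (nabla f))))
         \<and> convergent_scheme N S"
proof -
  obtain M E where "perturbed_mask_scheme p (\<lambda>l r. \<Lambda> l 0 ! r) S (correction p \<Lambda> \<pi>1) M E"
    using class_B_perturbed_mask_scheme[OF assms(1,2,3,5)] by blast
  then interpret perturbed_mask_scheme p "\<lambda>l r. \<Lambda> l 0 ! r" S "correction p \<Lambda> \<pi>1" M E .
  define T :: "(real ^ 'n) seqop" where "T = uniform_operator p (\<lambda>l x. pairing (\<Lambda> l 0) x)"
  have len: "length (\<Lambda> l 0) = 2 * p + 2" if "l \<in> {0, 1}" for l
    using assms(2) that unfolding class_B_def by blast
  have T_eq: "T = mask_operator p (\<lambda>l r. \<Lambda> l 0 ! r)"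
    unfolding T_def by (rule uniform_operator_eq_mask_operator) (rule len)
  then have maps_T: "maps_linf T"
    by (simp add: maps_linf_def mask_operator_in_linf)
  have "linear_subdivision_operator T"
    unfolding T_def using maps_T[unfolded T_def]
    by (rule linear_subdivision_operator_uniform_operator) (rule linear_rule_pairing[OF len])
  moreover have "stationary_scheme (\<lambda>k. T)"
    unfolding T_def by (rule stationary_scheme_uniform_operator[OF maps_T[unfolded T_def]])
  moreover have "convergent_scheme N (\<lambda>k. T)"
    using assms(2) unfolding class_B_def T_def by blast
  moreover have "\<forall>k. \<forall>f\<in>linf. S k f = (\<lambda>i. T f i + correction p \<Lambda> \<pi>1 k (nabla f) i)"
    using S_eq T_eq by simp
  moreover obtain M' where "M' > 0"
    "\<forall>k. \<forall>\<delta>\<in>linf. supnorm N (correction p \<Lambda> \<pi>1 k \<delta>) \<le> M' * supnorm N \<delta>"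
    using supnorm_F_le[OF assms(1)] by blast
  moreover obtain K k0 where "\<forall>k\<ge>k0. \<forall>f\<in>linf.
      supnorm N (nabla (compose_from S k (Suc K) f)) \<le> 1 / 2 * supnorm N (nabla f)"
    using supnorm_nabla_contracts[OF assms(1)] by blast
  moreover have "(1 / 2 :: real) \<in> {0<..<1}" by simp
  ultimately have "linear_subdivision_operator T \<and> stationary_scheme (\<lambda>k. T) \<and>
      convergent_scheme N (\<lambda>k. T) \<and> (\<forall>k. maps_linf (correction p \<Lambda> \<pi>1 k)) \<and>
      (\<forall>k. \<forall>f\<in>linf. S k f = (\<lambda>i. T f i + correction p \<Lambda> \<pi>1 k (nabla f) i)) \<and>
      (\<exists>M>0. \<exists>c\<in>{0<..<1}. \<exists>k0 K. \<forall>k\<ge>k0.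
         (\<forall>\<delta>\<in>linf. supnorm N (correction p \<Lambda> \<pi>1 k \<delta>) \<le> M * supnorm N \<delta>) \<and>
         (\<forall>f\<in>linf. supnorm N (nabla (compose_from S k (Suc K) f)) \<le> c * supnorm N (nabla f)))"
    using F_maps_linf by blast
  then show ?thesis using convergent[OF assms(1)] by blast
qed

end
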